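(* If $p\ge 5$ is a prime, then $$\mathrm{ccn}(\mathrm{PSL}_2(p))=\begin{cases}2 &\text{if } p\equiv 1\pmod 4,\\ 3 &\text{if } p\equiv 3\pmod 4.\end{cases}$$
   Context: "Finite simple group" means non-abelian finite simple group. $\mathrm{PSL}_2(p)$ is the projective special linear group over the field with $p$ elements. A collection of non-empty subsets $S(G)\subseteq G$, one for each finite group $G$, is *characteristic* if for every homomorphism $\varphi\colon G\to H$ of finite groups we have $\varphi(S(G))\subseteq S(H)$. A characteristic collection $S$ is *ample* if $|S(G)|\ge 2$ for all finite simple groups $G$. The *characteristic covering number* $\mathrm{ccn}(G)$ of a finite group $G$ is the smallest integer $n$ such that if $S_1,\ldots,S_n$ are (not necessarily distinct) ample characteristic collections, then $S_1(G)\cdots S_n(G)=G$ (product of subsets of $G$); if no such $n$ exists, $\mathrm{ccn}(G)=\infty$. *)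

theory Defs
  imports "HOL-Algebra.SimpleGroups" "HOL-Number_Theory.Residues" "HOL-Library.Extended_Nat"
begin

definition finite_simple_nonab_group :: "('a, 'b) monoid_scheme \<Rightarrow> bool"
  where "finite_simple_nonab_group G \<longleftrightarrow>
    simple_group G \<and> finite (carrier G) \<and> \<not> comm_group G"

(*
  A collection of subsets, one for each finite group, cannot range over groups on all types at
  once.  It is given here on the finite groups whose elements are natural numbers; every finite
  group is isomorphic to one of these, and by functoriality a characteristic collection is
  determined by its values on them: see coll_at below.
*)
type_synonym collection = "nat monoid \<Rightarrow> nat set"

definition characteristic :: "collection \<Rightarrow> bool"
  where "characteristic S \<longleftrightarrow>
    (\<forall>G. group G \<and> finite (carrier G) \<longrightarrow> S G \<noteq> {} \<and> S G \<subseteq> carrier G) \<and>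
    (\<forall>G H \<phi>. group G \<and> finite (carrier G) \<and> group H \<and> finite (carrier H) \<and> \<phi> \<in> hom G H
      \<longrightarrow> \<phi> ` S G \<subseteq> S H)"

lemma characteristic_hom:
  assumes "characteristic S" "group G" "finite (carrier G)" "group H" "finite (carrier H)"
    and "\<phi> \<in> hom G H" "x \<in> S G"
  shows "\<phi> x \<in> S H"
  using assms unfolding characteristic_def by (meson image_subset_iff)

definition ample :: "collection \<Rightarrow> bool"
  where "ample S \<longleftrightarrow> (\<forall>G. finite_simple_nonab_group G \<longrightarrow> card (S G) \<ge> 2)"

(* The value of a collection at a finite group on an arbitrary type, transported along all
   isomorphisms from groups on the natural numbers. *)
definition coll_at :: "collection \<Rightarrow> ('a, 'b) monoid_scheme \<Rightarrow> 'a set"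
  where "coll_at S G = {\<phi> x | \<phi> x (N :: nat monoid). group N \<and> \<phi> \<in> iso N G \<and> x \<in> S N}"

lemma ex_nat_copy:
  fixes G :: "('a, 'b) monoid_scheme"
  assumes "group G" "finite (carrier G)"
  obtains N :: "nat monoid" and \<phi> where "group N" "finite (carrier N)" "\<phi> \<in> iso N G"
proof -
  interpret G: group G by fact
  from assms(2) obtain f :: "'a \<Rightarrow> nat" where f: "inj_on f (carrier G)"
    using finite_imp_inj_to_nat_seg by metis
  define g where "g = the_inv_into (carrier G) f"
  define N :: "nat monoid" where
    "N = \<lparr>carrier = f ` carrier G, monoid.mult = \<lambda>x y. f (g x \<otimes>\<^bsub>G\<^esub> g y), one = f \<one>\<^bsub>G\<^esub>\<rparr>"
  have gf: "g (f x) = x" if "x \<in> carrier G" for x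
    using the_inv_into_f_f[OF f that] by (simp add: g_def)
  have N: "group N"
  proof (rule groupI)
    fix x assume "x \<in> carrier N"
    then obtain a where a: "a \<in> carrier G" "x = f a" by (auto simp: N_def)
    show "\<exists>y\<in>carrier N. y \<otimes>\<^bsub>N\<^esub> x = \<one>\<^bsub>N\<^esub>"
      using a by (intro bexI[of _ "f (inv\<^bsub>G\<^esub> a)"]) (auto simp: N_def gf)
  qed (auto simp: N_def gf G.m_assoc)
  have "g \<in> iso N G"
    by (auto simp: iso_def hom_def bij_betw_def inj_on_def N_def gf image_image)
  with N show thesis
    using assms(2) by (intro that[of N g]) (simp_all add: N_def)
qed

lemma coll_at_hom:
  fixes G :: "('a, 'b) monoid_scheme" and H :: "('c, 'd) monoid_scheme"
  assumes S: "characteristic S"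
    and G: "group G" "finite (carrier G)" and H: "group H" "finite (carrier H)"
    and h: "h \<in> hom G H"
  shows "h ` coll_at S G \<subseteq> coll_at S H"
proof
  fix y assume "y \<in> h ` coll_at S G"
  then obtain \<phi> x and N :: "nat monoid"
    where N: "group N" "\<phi> \<in> iso N G" "x \<in> S N" "y = h (\<phi> x)"
    unfolding coll_at_def by blast
  obtain M :: "nat monoid" and \<psi> where M: "group M" "finite (carrier M)" "\<psi> \<in> iso M H"
    using ex_nat_copy[OF H] .
  define \<psi>' where "\<psi>' = inv_into (carrier M) \<psi>"
  have \<psi>': "\<psi>' \<in> iso H M"
    unfolding \<psi>'_def using group.iso_set_sym[OF M(1,3)] .
  have fin: "finite (carrier N)"
    using N(2) G(2) bij_betw_finite by (auto simp: iso_def)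
  have "x \<in> carrier N" using S N fin unfolding characteristic_def by blast
  moreover have \<phi>: "\<phi> \<in> hom N G" using N(2) by (simp add: iso_def)
  ultimately have y: "y \<in> carrier H" using h N(4) by (auto simp: hom_def)
  have "h \<circ> \<phi> \<in> hom N H" by (rule hom_compose[OF \<phi> h])
  then have "\<psi>' \<circ> (h \<circ> \<phi>) \<in> hom N M"
    by (rule hom_compose) (use \<psi>' in \<open>simp add: iso_def\<close>)
  from characteristic_hom[OF S N(1) fin M(1,2) this N(3)]
  have "\<psi>' y \<in> S M" by (simp add: N(4))
  moreover have "y = \<psi> (\<psi>' y)"
    using y M(3) unfolding \<psi>'_def by (auto simp: iso_def bij_betw_def f_inv_into_f)
  ultimately show "y \<in> coll_at S H" unfolding coll_at_def using M by blast
qed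

lemma coll_at_nat:
  fixes G :: "nat monoid"
  assumes S: "characteristic S" and G: "group G" "finite (carrier G)"
  shows "coll_at S G = S G"
proof
  show "S G \<subseteq> coll_at S G"
  proof
    fix x assume "x \<in> S G"
    with G(1) id_iso[of G] have "\<exists>\<phi> z (N :: nat monoid).
        x = \<phi> z \<and> group N \<and> \<phi> \<in> iso N G \<and> z \<in> S N"
      by (intro exI[of _ id] exI[of _ x] exI[of _ G]) simp
    then show "x \<in> coll_at S G" unfolding coll_at_def by simp
  qed
  show "coll_at S G \<subseteq> S G"
  proof
    fix y assume "y \<in> coll_at S G"
    then obtain \<phi> x and N :: "nat monoid"
      where N: "group N" "\<phi> \<in> iso N G" "x \<in> S N" "y = \<phi> x"
      unfolding coll_at_def by blast
    have "finite (carrier N)"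
      using N(2) G(2) bij_betw_finite by (auto simp: iso_def)
    with N show "y \<in> S G"
      using characteristic_hom[OF S N(1) _ G _ N(3)] by (simp add: iso_def)
  qed
qed

definition set_prod :: "('a, 'b) monoid_scheme \<Rightarrow> 'a set list \<Rightarrow> 'a set"
  where "set_prod G As = foldr (set_mult G) As {\<one>\<^bsub>G\<^esub>}"

(* The infimum of the empty set in enat is infinity; otherwise Inf is the least element. *)
definition ccn :: "('a, 'b) monoid_scheme \<Rightarrow> enat"
  where "ccn G = Inf {enat n | n.
    \<forall>Ss. length Ss = n \<and> (\<forall>S \<in> set Ss. characteristic S \<and> ample S) \<longrightarrow>
      set_prod G (map (\<lambda>S. coll_at S G) Ss) = carrier G}"

(* The quadruple (a, b, c, d) stands for the matrix with rows (a, b) and (c, d). *)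
definition SL2 :: "('a, 'b) ring_scheme \<Rightarrow> ('a \<times> 'a \<times> 'a \<times> 'a) monoid"
  where "SL2 R =
    \<lparr>carrier = {(a, b, c, d). a \<in> carrier R \<and> b \<in> carrier R \<and> c \<in> carrier R \<and> d \<in> carrier R \<and>
        a \<otimes>\<^bsub>R\<^esub> d \<ominus>\<^bsub>R\<^esub> b \<otimes>\<^bsub>R\<^esub> c = \<one>\<^bsub>R\<^esub>},
     monoid.mult = \<lambda>(a, b, c, d) (a', b', c', d').
        (a \<otimes>\<^bsub>R\<^esub> a' \<oplus>\<^bsub>R\<^esub> b \<otimes>\<^bsub>R\<^esub> c', a \<otimes>\<^bsub>R\<^esub> b' \<oplus>\<^bsub>R\<^esub> b \<otimes>\<^bsub>R\<^esub> d',
         c \<otimes>\<^bsub>R\<^esub> a' \<oplus>\<^bsub>R\<^esub> d \<otimes>\<^bsub>R\<^esub> c', c \<otimes>\<^bsub>R\<^esub> b' \<oplus>\<^bsub>R\<^esub> d \<otimes>\<^bsub>R\<^esub> d'),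
     one = (\<one>\<^bsub>R\<^esub>, \<zero>\<^bsub>R\<^esub>, \<zero>\<^bsub>R\<^esub>, \<one>\<^bsub>R\<^esub>)\<rparr>"

definition SL2_scalars :: "('a, 'b) ring_scheme \<Rightarrow> ('a \<times> 'a \<times> 'a \<times> 'a) set"
  where "SL2_scalars R = {(a, \<zero>\<^bsub>R\<^esub>, \<zero>\<^bsub>R\<^esub>, a) | a. True} \<inter> carrier (SL2 R)"

definition PSL2 :: "nat \<Rightarrow> (int \<times> int \<times> int \<times> int) set monoid"
  where "PSL2 p = SL2 (residue_ring (int p)) Mod SL2_scalars (residue_ring (int p))"

end

theory Submission
  imports Defs "HOL-Number_Theory.Euler_Criterion"
begin

text \<open>
  Why three factors suffice, and two if \<open>[p = 1] (mod 4)\<close>. As PSL(2,p) is simple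
  (\<open>finite_simple_PSL\<close>), an ample characteristic collection takes on it a value that contains 1
  and a nontrivial element and that is invariant under all automorphisms. Conjugation by
  GL(2,p) is among these, and two nonscalar matrices of determinant 1 and equal trace are
  conjugate in GL(2,p) because both are conjugate to the companion matrix
  (\<open>companion_conj\<close>). So for some trace \<open>t\<close> the value contains every nonscalar class of
  trace \<open>t\<close> (\<open>coll_at_contains_trace\<close>). To write the companion matrix of trace \<open>r\<close> as a product
  of matrices of determinant 1 and traces \<open>t\<close> and \<open>s\<close> means to find a point on a conic, which
  exists if \<open>(r^2-4)b^2 + (2rt-4s)b + t^2-4\<close> is a square for some \<open>b\<close> (\<open>companion_factor\<close>).
  By the pigeonhole principle a nonconstant polynomial of degree at most two takes a square value.
  As traces matter only up to sign, the one remaining case is \<open>r = \<plusminus> 2\<close> and \<open>t = s = 0\<close>, where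
  \<open>-4\<close> has to be a square, that is, \<open>[p = 1] (mod 4)\<close> (\<open>product_covers\<close>). For three
  factors this case is avoided, since the product of the last two contains all nonscalar classes
  of trace 1.

  Why fewer factors do not suffice. A transvection is not an involution, and it is a product of
  two elements of square 1 only if \<open>-1\<close> is a square modulo \<open>p\<close>. It is therefore enough to have an
  ample characteristic collection whose value on PSL(2,p) consists of solutions of
  \<open>x^2 = 1\<close>. The collection \<open>{x. x^2 = 1}\<close> becomes ample for trivial reasons when all images of
  simple groups without involutions are added to it, and this leaves its value on
  PSL(2,p) unchanged because such a group \<open>H\<close> has only the trivial homomorphism to
  PSL(2,p) (\<open>odd_simple_hom_trivial\<close>).

  To see this, suppose that \<open>H\<close> embeds. The centralizer of a nonscalar matrix is commutative, and the
  absence of involutions (matrices of trace 0) carries this over to \<open>H\<close>: commuting is a transitive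
  relation on \<open>H - {1}\<close>. If \<open>H\<close> contains a transvection, then all its conjugates commute
  with it, since otherwise a product of a power of it with one of them has trace 0; its centralizer
  is then normal, hence all of \<open>H\<close>. If \<open>H\<close> contains no transvection, then all centralizers of
  nontrivial elements are their own normalizers, and counting the conjugates of centralizers shows
  that \<open>H\<close> is commutative (\<open>commutative_by_centralizer_count\<close>).
\<close>

section \<open>Groups in which commuting is transitive\<close>

context group begin

definition centralizer :: "'a \<Rightarrow> 'a set"
  where "centralizer g = {x \<in> carrier G. x \<otimes> g = g \<otimes> x}"

definition commutation_transitive :: bool
  where "commutation_transitive \<longleftrightarrow>
    (\<forall>g \<in> carrier G - {\<one>}. \<forall>x \<in> centralizer g. \<forall>y \<in> centralizer g. x \<otimes> y = y \<otimes> x)"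

lemma centralizer_sym: "x \<in> centralizer g \<Longrightarrow> g \<in> carrier G \<Longrightarrow> g \<in> centralizer x"
  by (simp add: centralizer_def)

lemma centralizer_trans:
  assumes "commutation_transitive" "g \<in> carrier G" "g \<noteq> \<one>" "x \<in> centralizer g" "y \<in> centralizer g"
  shows "x \<in> centralizer y"
  using assms unfolding commutation_transitive_def centralizer_def by simp

lemma conj_eq_iff_commute:
  assumes "x \<in> carrier G" "a \<in> carrier G"
  shows "x \<otimes> a \<otimes> inv x = a \<longleftrightarrow> x \<otimes> a = a \<otimes> x"
  using assms by (metis inv_solve_right m_closed)

lemma conj_eq_one_iff: "x \<in> carrier G \<Longrightarrow> a \<in> carrier G \<Longrightarrow> x \<otimes> a \<otimes> inv x = \<one> \<longleftrightarrow> a = \<one>"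
  by (metis inv_closed l_cancel_one' m_closed r_inv inv_solve_right l_one)

lemma inv_mult_cancel: "x \<in> carrier G \<Longrightarrow> y \<in> carrier G \<Longrightarrow> inv x \<otimes> (x \<otimes> y) = y"
  by (simp flip: m_assoc)

lemma conj_mult:
  assumes "x \<in> carrier G" "a \<in> carrier G" "b \<in> carrier G"
  shows "(x \<otimes> a \<otimes> inv x) \<otimes> (x \<otimes> b \<otimes> inv x) = x \<otimes> (a \<otimes> b) \<otimes> inv x"
  using assms by (simp add: m_assoc inv_mult_cancel)

lemma conj_centralizer:
  assumes "x \<in> carrier G" "g \<in> carrier G" "a \<in> centralizer g"
  shows "x \<otimes> a \<otimes> inv x \<in> centralizer (x \<otimes> g \<otimes> inv x)"
  using assms by (simp add: centralizer_def conj_mult)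

lemma conj_eq_conj:
  assumes "x \<in> carrier G" "y \<in> carrier G" "a \<in> carrier G" "b \<in> carrier G"
    and "x \<otimes> a \<otimes> inv x = y \<otimes> b \<otimes> inv y"
  shows "(inv y \<otimes> x) \<otimes> a \<otimes> inv (inv y \<otimes> x) = b"
proof -
  have "(inv y \<otimes> x) \<otimes> a \<otimes> inv (inv y \<otimes> x) = inv y \<otimes> (x \<otimes> a \<otimes> inv x) \<otimes> y"
    using assms(1-4) by (simp add: inv_mult_group m_assoc)
  also have "\<dots> = b"
    unfolding assms(5) using assms(1-4) by (simp add: m_assoc inv_mult_cancel)
  finally show ?thesis .
qed

lemma square_in_centralizer_if_inverts:
  assumes x: "x \<in> carrier G" and g: "g \<in> carrier G" and inv: "x \<otimes> g \<otimes> inv x = inv g"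
  shows "x \<otimes> x \<in> centralizer g"
proof -
  have "inv g \<otimes> x = (x \<otimes> g \<otimes> inv x) \<otimes> x" by (simp only: inv)
  also have "\<dots> = x \<otimes> g" using x g by (simp add: m_assoc)
  finally have xg: "x \<otimes> g = inv g \<otimes> x" ..
  have "g \<otimes> x \<otimes> g = x" using x g by (simp add: m_assoc xg) (simp flip: m_assoc)
  then have "x \<otimes> inv g = g \<otimes> x" using x g by (metis inv_solve_right m_closed)
  then have "x \<otimes> (inv g \<otimes> x) = g \<otimes> x \<otimes> x" using x g by (simp flip: m_assoc)
  then show ?thesis using x g by (simp add: centralizer_def m_assoc xg)
qed

lemma in_centralizer_square: "x \<in> carrier G \<Longrightarrow> x \<in> centralizer (x \<otimes> x)"
  by (simp add: centralizer_def m_assoc)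

definition centralizer_conjugates :: "'a \<Rightarrow> 'a set"
  where "centralizer_conjugates g =
    (\<lambda>(x, a). x \<otimes> a \<otimes> inv x) ` (carrier G \<times> (centralizer g - {\<one>}))"

text \<open>
  Double counting of the pairs \<open>(x, a)\<close>: if two of them have the same value \<open>x a inv x\<close>, the quotient
  of the first components conjugates one element of the centralizer of \<open>g\<close> to another; since commuting
  is transitive and centralizers are self-normalizing, it lies in that centralizer. So all fibres
  have the size of the centralizer.
\<close>

lemma card_centralizer_conjugates:
  assumes fin: "finite (carrier G)" and ct: "commutation_transitive"
    and sn: "\<And>g x. g \<in> carrier G \<Longrightarrow> g \<noteq> \<one> \<Longrightarrow> x \<in> carrier G \<Longrightarrow>
      x \<otimes> g \<otimes> inv x \<in> centralizer g \<Longrightarrow> x \<in> centralizer g"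
    and g: "g \<in> carrier G" "g \<noteq> \<one>"
  shows "card (centralizer_conjugates g) * card (centralizer g) =
    card (carrier G) * (card (centralizer g) - 1)"
proof -
  let ?C = "centralizer g"
  let ?S = "carrier G \<times> (?C - {\<one>})"
  let ?f = "\<lambda>(x, a). x \<otimes> a \<otimes> inv x"
  have C: "?C \<subseteq> carrier G" "\<one> \<in> ?C" using g by (auto simp: centralizer_def)
  have finC: "finite ?C" using C fin finite_subset by blast
  have fibre: "card {z \<in> ?S. ?f z = y} = card ?C" if y: "y \<in> centralizer_conjugates g" for y
  proof -
    obtain u b where u: "u \<in> carrier G" and b: "b \<in> ?C" "b \<noteq> \<one>" and y: "y = u \<otimes> b \<otimes> inv u"
      using y by (auto simp: centralizer_conjugates_def)
    have bG: "b \<in> carrier G" using b C by blast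
    have "{z \<in> ?S. ?f z = y} = (\<lambda>c. (u \<otimes> c, b)) ` ?C"
    proof (intro equalityI subsetI)
      fix z assume "z \<in> {z \<in> ?S. ?f z = y}"
      then obtain x a where z: "z = (x, a)" "x \<in> carrier G" "a \<in> ?C" "a \<noteq> \<one>"
        and eq: "x \<otimes> a \<otimes> inv x = u \<otimes> b \<otimes> inv u" using y by auto
      have aG: "a \<in> carrier G" using z C by blast
      define w where "w = inv u \<otimes> x"
      have w: "w \<in> carrier G" using u z by (simp add: w_def)
      have wa: "w \<otimes> a \<otimes> inv w = b"
        unfolding w_def by (rule conj_eq_conj) (use u z aG bG eq in auto)
      have "b \<in> centralizer a" using centralizer_trans[OF ct g b(1) z(3)] .
      then have wca: "w \<in> centralizer a" using sn[OF aG z(4) w] wa by simp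
      then have "a = b" using wa conj_eq_iff_commute[OF w aG] by (simp add: centralizer_def)
      moreover have "g \<in> centralizer a" using centralizer_sym[OF z(3) g(1)] .
      then have "w \<in> ?C" using centralizer_trans[OF ct aG z(4) wca] by blast
      moreover have "x = u \<otimes> w" using u z by (simp add: w_def flip: m_assoc)
      ultimately show "z \<in> (\<lambda>c. (u \<otimes> c, b)) ` ?C" using z by blast
    next
      fix z assume "z \<in> (\<lambda>c. (u \<otimes> c, b)) ` ?C"
      then obtain c where c: "c \<in> ?C" "z = (u \<otimes> c, b)" by blast
      have cG: "c \<in> carrier G" using c C by blast
      have "c \<in> centralizer b" using centralizer_trans[OF ct g c(1) b(1)] .
      then have cb: "c \<otimes> b \<otimes> inv c = b" using conj_eq_iff_commute[OF cG bG] by (simp add: centralizer_def)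
      have "u \<otimes> c \<otimes> b \<otimes> inv (u \<otimes> c) = u \<otimes> (c \<otimes> b \<otimes> inv c) \<otimes> inv u"
        using u cG bG by (simp add: inv_mult_group m_assoc)
      then show "z \<in> {z \<in> ?S. ?f z = y}" using c u cG b by (simp add: y cb)
    qed
    moreover have "inj_on (\<lambda>c. (u \<otimes> c, b)) ?C"
      using u C by (auto simp: subset_iff intro!: inj_onI)
    ultimately show ?thesis by (simp add: card_image)
  qed
  have "finite ?S" using fin finC by blast
  then have "card ?S = (\<Sum>y\<in>?f ` ?S. card {z \<in> ?S. ?f z = y})"
    using sum.image_gen[of ?S "\<lambda>_. 1 :: nat" ?f] by simp
  also have "\<dots> = (\<Sum>y\<in>centralizer_conjugates g. card ?C)"
    unfolding centralizer_conjugates_def[symmetric] by (intro sum.cong refl fibre)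
  finally show ?thesis using C finC by (simp add: card_cartesian_product)
qed

text \<open>
  By the count above, the conjugates of one centralizer contain, apart from 1, at least half as many
  elements as the group has. If they miss a nontrivial \<open>h\<close>, then the conjugates of the centralizer of
  \<open>h\<close> are disjoint from them outside 1, and together these sets need more than the \<open>|G| - 1\<close> places
  available. So they miss nothing, and then the count says that the centralizer is the whole group.
\<close>

lemma commutative_by_centralizer_count:
  assumes fin: "finite (carrier G)" and ct: "commutation_transitive"
    and sn: "\<And>g x. g \<in> carrier G \<Longrightarrow> g \<noteq> \<one> \<Longrightarrow> x \<in> carrier G \<Longrightarrow>
      x \<otimes> g \<otimes> inv x \<in> centralizer g \<Longrightarrow> x \<in> centralizer g"
    and xy: "x \<in> carrier G" "y \<in> carrier G"
  shows "x \<otimes> y = y \<otimes> x"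
proof (cases "x = \<one>")
  case False
  let ?n = "card (carrier G)" and ?K = centralizer_conjugates
  have half: "?n \<le> 2 * card (?K g)" if g: "g \<in> carrier G" "g \<noteq> \<one>" for g
  proof -
    let ?c = "card (centralizer g)"
    have "{\<one>, g} \<subseteq> centralizer g" "centralizer g \<subseteq> carrier G" using g by (auto simp: centralizer_def)
    then have "card {\<one>, g} \<le> ?c" using fin finite_subset card_mono by metis
    then have c: "2 \<le> ?c" using g by auto
    then have "?n * ?c \<le> ?n * (2 * (?c - 1))" by (intro mult_le_mono2) simp
    also have "\<dots> = 2 * card (?K g) * ?c"
      using card_centralizer_conjugates[OF fin ct sn g] by simp
    finally show ?thesis using c by simp
  qed
  have sub: "?K g \<subseteq> carrier G - {\<one>}" if "g \<in> carrier G" for g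
    by (auto simp: centralizer_conjugates_def centralizer_def conj_eq_one_iff)
  have pos: "?n > 0" using fin xy by (auto simp: card_gt_0_iff)
  have "?K x = carrier G - {\<one>}"
  proof (rule ccontr)
    assume "?K x \<noteq> carrier G - {\<one>}"
    then obtain h where h: "h \<in> carrier G" "h \<noteq> \<one>" "h \<notin> ?K x" using sub[OF xy(1)] by blast
    have "?K x \<inter> ?K h = {}"
    proof (rule ccontr)
      assume "?K x \<inter> ?K h \<noteq> {}"
      then obtain u a v b where u: "u \<in> carrier G" "a \<in> centralizer x" "a \<noteq> \<one>"
        and v: "v \<in> carrier G" "b \<in> centralizer h" "b \<noteq> \<one>" and eq: "u \<otimes> a \<otimes> inv u = v \<otimes> b \<otimes> inv v"
        by (auto simp: centralizer_conjugates_def)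
      have aG: "a \<in> carrier G" and bG: "b \<in> carrier G" using u v by (auto simp: centralizer_def)
      define w where "w = inv u \<otimes> v"
      have w: "w \<in> carrier G" using u v by (simp add: w_def)
      have "w \<otimes> b \<otimes> inv w = a"
        unfolding w_def by (rule conj_eq_conj) (use u v aG bG eq in auto)
      then have "w \<otimes> h \<otimes> inv w \<in> centralizer a"
        using conj_centralizer[OF w bG centralizer_sym[OF v(2) h(1)]] by simp
      then have "w \<otimes> h \<otimes> inv w \<in> centralizer x"
        using centralizer_trans[OF ct aG u(3) _ centralizer_sym[OF u(2) xy(1)]] by blast
      moreover have "w \<otimes> h \<otimes> inv w \<noteq> \<one>" using conj_eq_one_iff[OF w h(1)] h(2) by blast
      moreover have "h = inv w \<otimes> (w \<otimes> h \<otimes> inv w) \<otimes> inv (inv w)"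
        using w h by (simp add: m_assoc inv_mult_cancel)
      ultimately have "h \<in> ?K x" unfolding centralizer_conjugates_def using w
        by (intro image_eqI[of _ _ "(inv w, w \<otimes> h \<otimes> inv w)"]) auto
      with h show False by blast
    qed
    moreover have finK: "finite (?K x)" "finite (?K h)"
      using sub xy h fin finite_subset by (meson finite_Diff)+
    ultimately have "card (?K x) + card (?K h) = card (?K x \<union> ?K h)" by (simp add: card_Un_disjoint)
    also have "\<dots> \<le> card (carrier G - {\<one>})" by (intro card_mono) (use fin sub xy h in auto)
    also have "\<dots> < ?n" using pos by simp
    finally show False using half[OF xy(1) False] half[OF h(1,2)] by linarith
  qed
  then have "(?n - 1) * card (centralizer x) = ?n * (card (centralizer x) - 1)"
    using card_centralizer_conjugates[OF fin ct sn xy(1) False] by simp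
  moreover have sC: "centralizer x \<subseteq> carrier G" by (auto simp: centralizer_def)
  moreover have "card (centralizer x) > 0"
    using xy fin finite_subset[OF sC] by (auto simp: card_gt_0_iff centralizer_def)
  ultimately have "card (centralizer x) = ?n"
    using pos by (simp add: diff_mult_distrib diff_mult_distrib2)
      (metis Suc_leI Suc_pred diff_diff_cancel le_add1 mult_Suc mult_Suc_right)
  then have "centralizer x = carrier G" using card_subset_eq[OF fin sC] by blast
  then have "y \<in> centralizer x" using xy by simp
  then show ?thesis by (simp add: centralizer_def)
qed (use xy in simp)

end

text \<open>
  Transitivity makes the centralizer of \<open>g\<close> a normal subgroup.
\<close>

lemma (in simple_group) commutative_if_conjugates_commute:
  assumes ct: "commutation_transitive" and g: "g \<in> carrier G" "g \<noteq> \<one>"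
    and conj: "\<And>x. x \<in> carrier G \<Longrightarrow> x \<otimes> g \<otimes> inv x \<in> centralizer g"
    and xy: "x \<in> carrier G" "y \<in> carrier G"
  shows "x \<otimes> y = y \<otimes> x"
proof -
  have sub: "centralizer g \<subseteq> carrier G" by (auto simp: centralizer_def)
  have "subgroup (centralizer g) G"
  proof (rule subgroupI)
    show "centralizer g \<noteq> {}" using g by (auto simp: centralizer_def)
    fix a assume a: "a \<in> centralizer g"
    then have "inv a \<otimes> g \<otimes> a = g" using g
      by (simp add: centralizer_def m_assoc) (metis inv_solve_left m_closed)
    with a g show "inv a \<in> centralizer g" by (simp add: centralizer_def) (metis inv_closed inv_solve_right m_closed)
    fix b assume b: "b \<in> centralizer g"
    with a g show "a \<otimes> b \<in> centralizer g" by (simp add: centralizer_def m_assoc) (metis m_assoc)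
  qed (fact sub)
  moreover have "x \<otimes> a \<otimes> inv x \<in> centralizer g" if x: "x \<in> carrier G" and a: "a \<in> centralizer g" for x a
  proof -
    have "x \<otimes> g \<otimes> inv x \<in> carrier G" "x \<otimes> g \<otimes> inv x \<noteq> \<one>"
      using x g conj_eq_one_iff by auto
    moreover have "x \<otimes> a \<otimes> inv x \<in> centralizer (x \<otimes> g \<otimes> inv x)" by (rule conj_centralizer[OF x g(1) a])
    moreover have "g \<in> centralizer (x \<otimes> g \<otimes> inv x)" by (rule centralizer_sym[OF conj[OF x] g(1)])
    ultimately show ?thesis by (rule centralizer_trans[OF ct])
  qed
  ultimately have "centralizer g \<lhd> G" by (intro normal_invI)
  moreover have "g \<in> centralizer g" using g by (simp add: centralizer_def)
  ultimately have "centralizer g = carrier G" using no_real_normal_subgroup[of "centralizer g"] g by blast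
  then show ?thesis using ct g xy unfolding commutation_transitive_def by auto
qed

section \<open>Integer matrices and the elements of PSL(2,p)\<close>

text \<open>
  Computations in SL(2,p) are done with integer matrices up to congruence, so that
  polynomial identities between their entries are identities in the ring of integers. The quadruple
  \<open>(a, b, c, d)\<close> has rows \<open>(a, b)\<close> and \<open>(c, d)\<close>.
\<close>

type_synonym int_mat = "int \<times> int \<times> int \<times> int"

fun mat_mul :: "int_mat \<Rightarrow> int_mat \<Rightarrow> int_mat" (infixl "\<star>" 70) where
  "(a, b, c, d) \<star> (a', b', c', d') =
     (a * a' + b * c', a * b' + b * d', c * a' + d * c', c * b' + d * d')"

fun mat_det :: "int_mat \<Rightarrow> int" where "mat_det (a, b, c, d) = a * d - b * c"

fun mat_tr :: "int_mat \<Rightarrow> int" where "mat_tr (a, b, c, d) = a + d"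

fun mat_adj :: "int_mat \<Rightarrow> int_mat" where "mat_adj (a, b, c, d) = (d, - b, - c, a)"

fun mat_scale :: "int \<Rightarrow> int_mat \<Rightarrow> int_mat" where
  "mat_scale k (a, b, c, d) = (k * a, k * b, k * c, k * d)"

abbreviation mat_id :: int_mat where "mat_id \<equiv> (1, 0, 0, 1)"

lemma mat_mul_assoc: "(k \<star> m) \<star> n = k \<star> (m \<star> n)"
  by (cases k; cases m; cases n) (simp add: algebra_simps)

lemma mat_id_mul [simp]: "mat_id \<star> m = m" and mat_mul_id [simp]: "m \<star> mat_id = m"
  by (cases m; simp)+

lemma mat_det_mul: "mat_det (m \<star> n) = mat_det m * mat_det n"
  by (cases m; cases n) (simp add: algebra_simps)

lemma mat_det_adj [simp]: "mat_det (mat_adj m) = mat_det m"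
  by (cases m) simp

lemma mat_det_scale: "mat_det (mat_scale k m) = k ^ 2 * mat_det m"
  by (cases m) (simp add: algebra_simps power2_eq_square)

lemma mat_tr_scale: "mat_tr (mat_scale k m) = k * mat_tr m"
  by (cases m) (simp add: algebra_simps)

lemma mat_adj_mul: "mat_adj m \<star> m = mat_scale (mat_det m) mat_id"
  and mat_mul_adj: "m \<star> mat_adj m = mat_scale (mat_det m) mat_id"
  by (cases m; simp add: algebra_simps)+

lemma mat_scale_mul: "mat_scale k m \<star> n = mat_scale k (m \<star> n)"
  and mat_mul_scale: "m \<star> mat_scale k n = mat_scale k (m \<star> n)"
  by (cases m; cases n; simp add: algebra_simps)+

lemma mat_scale_scale: "mat_scale k (mat_scale l m) = mat_scale (k * l) m"
  by (cases m) simp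

lemma mat_scale_1 [simp]: "mat_scale 1 m = m"
  by (cases m) simp

lemma mat_tr_commute: "mat_tr (m \<star> n) = mat_tr (n \<star> m)"
  by (cases m; cases n) (simp add: algebra_simps)

locale psl2_prime =
  fixes p :: nat
  assumes prime_p: "Factorial_Ring.prime p" and p_ge_5: "p \<ge> 5"
begin

abbreviation P :: int where "P \<equiv> int p"
abbreviation R where "R \<equiv> residue_ring P"
abbreviation SL where "SL \<equiv> SL2 R"
abbreviation PSL where "PSL \<equiv> PSL2 p"

fun mat_cong :: "int_mat \<Rightarrow> int_mat \<Rightarrow> bool" (infix "\<cong>\<^sub>p" 50) where
  "mat_cong (a, b, c, d) (a', b', c', d') \<longleftrightarrow>
     [a = a'] (mod P) \<and> [b = b'] (mod P) \<and> [c = c'] (mod P) \<and> [d = d'] (mod P)"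

fun mat_red :: "int_mat \<Rightarrow> int_mat" where
  "mat_red (a, b, c, d) = (a mod P, b mod P, c mod P, d mod P)"

abbreviation unimodular :: "int_mat \<Rightarrow> bool"
  where "unimodular m \<equiv> [mat_det m = 1] (mod P)"

lemma prime_P: "Factorial_Ring.prime P"
  using prime_p by simp

lemma P_ge_5: "P \<ge> 5"
  using p_ge_5 by simp

interpretation res: residues P R
  by unfold_locales (use p_ge_5 in auto)

lemma mat_red_eq_iff: "mat_red m = mat_red n \<longleftrightarrow> m \<cong>\<^sub>p n"
  by (cases m; cases n) (simp add: cong_def)

lemma mat_cong_refl [simp]: "m \<cong>\<^sub>p m"
  by (cases m) simp

lemma mat_cong_sym: "m \<cong>\<^sub>p n \<Longrightarrow> n \<cong>\<^sub>p m"
  by (simp flip: mat_red_eq_iff)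

lemma mat_cong_trans [trans]: "k \<cong>\<^sub>p m \<Longrightarrow> m \<cong>\<^sub>p n \<Longrightarrow> k \<cong>\<^sub>p n"
  by (simp flip: mat_red_eq_iff)

lemma mat_cong_mul: "m \<cong>\<^sub>p m' \<Longrightarrow> n \<cong>\<^sub>p n' \<Longrightarrow> m \<star> n \<cong>\<^sub>p m' \<star> n'"
  by (cases m; cases n; cases m'; cases n') (auto intro!: cong_add cong_mult)

lemma mat_cong_scale: "[k = l] (mod P) \<Longrightarrow> m \<cong>\<^sub>p n \<Longrightarrow> mat_scale k m \<cong>\<^sub>p mat_scale l n"
  by (cases m; cases n) (auto intro!: cong_mult)

lemma mat_cong_det: "m \<cong>\<^sub>p n \<Longrightarrow> [mat_det m = mat_det n] (mod P)"
  by (cases m; cases n) (auto intro!: cong_diff cong_mult)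

lemma mat_cong_tr: "m \<cong>\<^sub>p n \<Longrightarrow> [mat_tr m = mat_tr n] (mod P)"
  by (cases m; cases n) (auto intro!: cong_add)

lemma unimodular_mul: "unimodular m \<Longrightarrow> unimodular n \<Longrightarrow> unimodular (m \<star> n)"
  unfolding mat_det_mul using cong_mult by fastforce

lemma unimodular_minus: "unimodular m \<Longrightarrow> unimodular (mat_scale (-1) m)"
  by (simp add: mat_det_scale)

lemma SL_mult: "mat_red m \<otimes>\<^bsub>SL\<^esub> mat_red n = mat_red (m \<star> n)"
proof -
  have "(x mod P * (x' mod P) + y mod P * (y' mod P)) mod P = (x * x' + y * y') mod P" for x y x' y'
    by (rule mod_add_cong; rule mod_mult_eq)
  then show ?thesis
    by (cases m; cases n) (simp add: SL2_def residue_ring_def mod_simps)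
qed

lemma SL_one: "\<one>\<^bsub>SL\<^esub> = mat_red mat_id"
  using p_ge_5 by (simp add: SL2_def residue_ring_def)

lemma SL_carrier: "carrier SL = mat_red ` {m. unimodular m}"
proof -
  have det: "a \<otimes>\<^bsub>R\<^esub> d \<ominus>\<^bsub>R\<^esub> b \<otimes>\<^bsub>R\<^esub> c = (a * d - b * c) mod P" for a b c d
    by (simp add: a_minus_def res.res_mult_eq res.res_add_eq res.res_neg_eq mod_simps)
  show ?thesis
  proof (intro equalityI subsetI)
    fix x assume x: "x \<in> carrier SL"
    obtain a b c d where [simp]: "x = (a, b, c, d)" by (cases x)
    have r: "a mod P = a" "b mod P = b" "c mod P = c" "d mod P = d"
      using x by (auto simp: SL2_def res.res_carrier_eq)
    have "unimodular (a, b, c, d)"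
      using x p_ge_5 by (simp add: SL2_def det res.res_one_eq cong_def)
    then show "x \<in> mat_red ` {m. unimodular m}"
      by (intro image_eqI[of _ _ "(a, b, c, d)"]) (simp_all add: r)
  next
    fix x assume "x \<in> mat_red ` {m. unimodular m}"
    then obtain a b c d where x: "x = mat_red (a, b, c, d)" "[a * d - b * c = 1] (mod P)"
      by auto
    have "(a mod P * (d mod P) - b mod P * (c mod P)) mod P = (a * d - b * c) mod P"
      by (rule mod_diff_cong; rule mod_mult_eq)
    with x show "x \<in> carrier SL"
      using p_ge_5 by (simp add: SL2_def det res.res_one_eq cong_def)
  qed
qed

lemma group_SL: "group SL"
proof (rule groupI)
  show "\<one>\<^bsub>SL\<^esub> \<in> carrier SL"
    unfolding SL_one SL_carrier by (intro imageI) simp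
next
  fix x y assume "x \<in> carrier SL" "y \<in> carrier SL"
  then obtain m n where x: "x = mat_red m" "unimodular m" and y: "y = mat_red n" "unimodular n"
    unfolding SL_carrier by blast
  show "x \<otimes>\<^bsub>SL\<^esub> y \<in> carrier SL"
    unfolding x y SL_mult unfolding SL_carrier
    by (intro imageI CollectI unimodular_mul x y)
  fix z assume "z \<in> carrier SL"
  then obtain k where z: "z = mat_red k" unfolding SL_carrier by blast
  show "x \<otimes>\<^bsub>SL\<^esub> y \<otimes>\<^bsub>SL\<^esub> z = x \<otimes>\<^bsub>SL\<^esub> (y \<otimes>\<^bsub>SL\<^esub> z)"
    unfolding x y z SL_mult mat_mul_assoc ..
next
  fix x assume "x \<in> carrier SL"
  then obtain m where m: "x = mat_red m" "unimodular m" unfolding SL_carrier by blast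
  show "\<one>\<^bsub>SL\<^esub> \<otimes>\<^bsub>SL\<^esub> x = x"
    unfolding m SL_one SL_mult mat_id_mul ..
  from m have "mat_scale (mat_det m) mat_id \<cong>\<^sub>p mat_scale 1 mat_id"
    by (intro mat_cong_scale) auto
  then have "mat_red (mat_adj m) \<otimes>\<^bsub>SL\<^esub> x = \<one>\<^bsub>SL\<^esub>"
    unfolding m SL_mult SL_one mat_adj_mul mat_red_eq_iff by simp
  moreover have "mat_red (mat_adj m) \<in> carrier SL"
    unfolding SL_carrier using m by (intro imageI) simp
  ultimately show "\<exists>y\<in>carrier SL. y \<otimes>\<^bsub>SL\<^esub> x = \<one>\<^bsub>SL\<^esub>" by blast
qed

lemma P_dvd_mult: "P dvd a * b \<longleftrightarrow> P dvd a \<or> P dvd b"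
  using prime_P prime_dvd_mult_iff by blast

lemma SL_scalars: "SL2_scalars R = mat_red ` {mat_id, mat_scale (-1) mat_id}"
proof (intro equalityI subsetI)
  fix x assume x: "x \<in> SL2_scalars R"
  then obtain a where a: "x = (a, 0, 0, a)" by (auto simp: SL2_scalars_def res.res_zero_eq)
  with x obtain m where m: "x = mat_red m" "unimodular m" by (auto simp: SL2_scalars_def SL_carrier)
  have a': "a mod P = a" using m a by (cases m) (auto simp: mod_simps)
  then have x': "x = mat_red (a, 0, 0, a)" using a by simp
  with m have "m \<cong>\<^sub>p (a, 0, 0, a)" by (metis mat_red_eq_iff)
  from mat_cong_det[OF this] m(2) have "[a * a = 1] (mod P)"
    by simp (metis cong_sym cong_trans)
  then have "P dvd (a - 1) * (a + 1)" by (simp add: cong_iff_dvd_diff algebra_simps)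
  then have "[a = 1] (mod P) \<or> [a = -1] (mod P)"
    unfolding P_dvd_mult by (simp add: cong_iff_dvd_diff)
  then show "x \<in> mat_red ` {mat_id, mat_scale (-1) mat_id}"
    unfolding x' by (auto simp: mat_red_eq_iff cong_def)
next
  fix x assume "x \<in> mat_red ` {mat_id, mat_scale (-1) mat_id}"
  then obtain k where k: "x = mat_red (k, 0, 0, k)" "[k * k = 1] (mod P)"
    by auto
  then have "x \<in> carrier SL" unfolding SL_carrier by (intro image_eqI[of _ _ "(k, 0, 0, k)"]) simp_all
  with k show "x \<in> SL2_scalars R" by (auto simp: SL2_scalars_def res.res_zero_eq)
qed

lemma normal_scalars: "SL2_scalars R \<lhd> SL"
proof -
  interpret group SL by (rule group_SL)
  have "subgroup (SL2_scalars R) SL"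
  proof (rule subgroupI)
    show "SL2_scalars R \<subseteq> carrier SL" by (simp add: SL2_scalars_def)
    show "SL2_scalars R \<noteq> {}" by (simp add: SL_scalars)
    have mult: "a \<otimes>\<^bsub>SL\<^esub> b \<in> SL2_scalars R"
      if "a \<in> SL2_scalars R" "b \<in> SL2_scalars R" for a b
      using that by (auto simp: SL_scalars SL_mult simp del: mat_red.simps)
    show "\<And>a b. a \<in> SL2_scalars R \<Longrightarrow> b \<in> SL2_scalars R \<Longrightarrow> a \<otimes>\<^bsub>SL\<^esub> b \<in> SL2_scalars R"
      by (rule mult)
    fix a assume a: "a \<in> SL2_scalars R"
    then have c: "a \<in> carrier SL" by (simp add: SL2_scalars_def)
    have "a \<otimes>\<^bsub>SL\<^esub> a = \<one>\<^bsub>SL\<^esub>"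
      using a by (auto simp: SL_scalars SL_mult SL_one simp del: mat_red.simps)
    with c have "inv\<^bsub>SL\<^esub> a = a" by (metis inv_equality)
    with a show "inv\<^bsub>SL\<^esub> a \<in> SL2_scalars R" by simp
  qed
  moreover have "x \<otimes>\<^bsub>SL\<^esub> h \<otimes>\<^bsub>SL\<^esub> inv\<^bsub>SL\<^esub> x \<in> SL2_scalars R"
    if x: "x \<in> carrier SL" and h: "h \<in> SL2_scalars R" for x h
  proof -
    obtain m where m: "x = mat_red m" using x unfolding SL_carrier by blast
    obtain k where k: "h = mat_red (mat_scale k mat_id)"
      using h unfolding SL_scalars image_insert image_empty
      by (elim insertE emptyE) (use that[of 1] that[of "-1"] in simp_all)
    have "x \<otimes>\<^bsub>SL\<^esub> h = h \<otimes>\<^bsub>SL\<^esub> x"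
      unfolding m k SL_mult mat_scale_mul mat_mul_scale mat_id_mul mat_mul_id ..
    moreover have "h \<in> carrier SL" using h by (simp add: SL2_scalars_def)
    ultimately show ?thesis using x h by (simp add: m_assoc)
  qed
  ultimately show ?thesis by (intro normal_invI)
qed

text \<open>
  The element of PSL(2,p) that an integer matrix of determinant 1 modulo \<open>p\<close> represents. The lemmas
  from here to \<open>proj_cong\<close> are all that the rest of the proof uses about the coset construction.
\<close>

definition proj :: "int_mat \<Rightarrow> int_mat set"
  where "proj m = SL2_scalars R #>\<^bsub>SL\<^esub> mat_red m"

lemma proj_eq: "proj m = {mat_red m, mat_red (mat_scale (-1) m)}"
  unfolding proj_def r_coset_def SL_scalars
  by (auto simp add: SL_mult mat_scale_mul simp del: mat_red.simps mat_scale.simps)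

lemma PSL_carrier: "carrier PSL = proj ` {m. unimodular m}"
  by (auto simp: PSL2_def FactGroup_def RCOSETS_def SL_carrier proj_def)

lemma PSL_mult:
  assumes "unimodular m" "unimodular n"
  shows "proj m \<otimes>\<^bsub>PSL\<^esub> proj n = proj (m \<star> n)"
proof -
  interpret normal "SL2_scalars R" SL by (rule normal_scalars)
  have "mat_red m \<in> carrier SL" "mat_red n \<in> carrier SL" using assms by (auto simp: SL_carrier)
  from rcos_sum[OF this] show ?thesis
    by (simp add: PSL2_def FactGroup_def proj_def SL_mult)
qed

lemma group_PSL: "group PSL"
  unfolding PSL2_def by (rule normal.factorgroup_is_group[OF normal_scalars])

lemma PSL_one: "\<one>\<^bsub>PSL\<^esub> = proj mat_id"
proof -
  have u: "unimodular mat_id" by simp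
  then have "proj mat_id \<otimes>\<^bsub>PSL\<^esub> proj mat_id = proj mat_id" by (simp add: PSL_mult)
  moreover have "proj mat_id \<in> carrier PSL" using u by (auto simp: PSL_carrier)
  ultimately show ?thesis using group.r_cancel_one'[OF group_PSL] by metis
qed

lemma finite_PSL: "finite (carrier PSL)"
proof -
  have "carrier SL \<subseteq> carrier R \<times> carrier R \<times> carrier R \<times> carrier R"
    by (auto simp: SL2_def)
  moreover have "finite (carrier R)" by (rule res.finite)
  ultimately have "finite (carrier SL)" by (meson finite_SigmaI finite_subset)
  then have "finite (mat_red ` {m. unimodular m})" by (simp only: SL_carrier)
  then have "finite ((\<lambda>x. SL2_scalars R #>\<^bsub>SL\<^esub> x) ` mat_red ` {m. unimodular m})"
    by (rule finite_imageI)
  then show ?thesis unfolding PSL_carrier proj_def image_image .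
qed

lemma proj_eq_iff: "proj m = proj n \<longleftrightarrow> m \<cong>\<^sub>p n \<or> m \<cong>\<^sub>p mat_scale (-1) n"
proof -
  have "mat_scale (-1) m \<cong>\<^sub>p mat_scale (-1) n" if "m \<cong>\<^sub>p n" for m n
    using that by (intro mat_cong_scale) auto
  from this[of m n] this[of m "mat_scale (-1) n"] show ?thesis
    by (auto simp: proj_eq mat_red_eq_iff doubleton_eq_iff mat_scale_scale
        simp del: mat_red.simps mat_scale.simps)
qed

lemma proj_minus: "proj (mat_scale (-1) m) = proj m"
  unfolding proj_eq_iff by (simp add: mat_scale_scale del: mat_scale.simps)

lemma proj_cong: "m \<cong>\<^sub>p n \<Longrightarrow> proj m = proj n"
  by (simp add: proj_eq_iff)

fun scalar_mat :: "int_mat \<Rightarrow> bool" where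
  "scalar_mat (a, b, c, d) \<longleftrightarrow> [b = 0] (mod P) \<and> [c = 0] (mod P) \<and> [a = d] (mod P)"

definition inverse_pair :: "int_mat \<Rightarrow> int_mat \<Rightarrow> bool"
  where "inverse_pair h h' \<longleftrightarrow> h \<star> h' \<cong>\<^sub>p mat_id \<and> h' \<star> h \<cong>\<^sub>p mat_id"

lemma ex_inverse_mod: "\<not> P dvd k \<Longrightarrow> \<exists>l. [k * l = 1] (mod P)"
  using prime_P by (meson cong_solve_coprime_int coprime_commute prime_imp_coprime)

lemma ex_inverse_pair:
  assumes "\<not> P dvd mat_det h"
  obtains h' where "inverse_pair h h'"
proof -
  obtain k where k: "[mat_det h * k = 1] (mod P)" using ex_inverse_mod assms by blast
  have "mat_scale (mat_det h * k) mat_id \<cong>\<^sub>p mat_scale 1 mat_id"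
    by (intro mat_cong_scale k) simp
  then have "inverse_pair h (mat_scale k (mat_adj h))"
    unfolding inverse_pair_def mat_scale_mul mat_mul_scale mat_adj_mul mat_mul_adj mat_scale_scale
    by (simp add: mult.commute)
  then show thesis by (rule that)
qed

lemma inverse_pair_sym: "inverse_pair h h' \<Longrightarrow> inverse_pair h' h"
  by (simp add: inverse_pair_def)

lemma mat_cong_cancel:
  assumes "h \<star> h' \<cong>\<^sub>p mat_id"
  shows "k \<star> h \<star> (h' \<star> m) \<cong>\<^sub>p k \<star> m"
proof -
  have "k \<star> (h \<star> h') \<star> m \<cong>\<^sub>p k \<star> mat_id \<star> m"
    by (intro mat_cong_mul assms mat_cong_refl)
  then show ?thesis by (simp add: mat_mul_assoc)
qed

lemma inverse_pair_mul:
  assumes "inverse_pair h h'" "inverse_pair k k'"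
  shows "inverse_pair (h \<star> k) (k' \<star> h')"
proof -
  have "h \<star> k \<star> (k' \<star> h') \<cong>\<^sub>p h \<star> h'" "k' \<star> h' \<star> (h \<star> k) \<cong>\<^sub>p k' \<star> k"
    using assms by (auto simp only: inverse_pair_def intro: mat_cong_cancel)
  with assms show ?thesis unfolding inverse_pair_def using mat_cong_trans by blast
qed

lemma unimodular_inverse_pair: "unimodular h \<Longrightarrow> inverse_pair h (mat_adj h)"
  unfolding inverse_pair_def mat_adj_mul mat_mul_adj
  using mat_cong_scale[of "mat_det h" 1 mat_id mat_id] by simp

lemma unimodular_conj:
  assumes "inverse_pair h h'" "unimodular m"
  shows "unimodular (h \<star> m \<star> h')"
proof -
  have "[mat_det (h \<star> h') = mat_det mat_id] (mod P)"
    using assms(1) unfolding inverse_pair_def by (intro mat_cong_det) blast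
  then have "[mat_det h * mat_det h' = 1] (mod P)" by (simp add: mat_det_mul)
  from cong_mult[OF this assms(2)] show ?thesis by (simp add: mat_det_mul algebra_simps)
qed

lemma mat_tr_conj:
  assumes "inverse_pair h h'"
  shows "[mat_tr (h \<star> m \<star> h') = mat_tr m] (mod P)"
proof -
  have "h' \<star> h \<star> m \<cong>\<^sub>p mat_id \<star> m"
    using assms unfolding inverse_pair_def by (intro mat_cong_mul) auto
  from mat_cong_tr[OF this] have "[mat_tr (h' \<star> (h \<star> m)) = mat_tr m] (mod P)"
    by (simp add: mat_mul_assoc)
  then show ?thesis by (metis mat_tr_commute)
qed

lemma scalar_mat_iff: "scalar_mat m \<longleftrightarrow> (\<exists>k. m \<cong>\<^sub>p mat_scale k mat_id)"
  by (cases m) (auto simp: cong_def)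

lemma conj_undo:
  assumes "inverse_pair h h'"
  shows "h' \<star> (h \<star> m \<star> h') \<star> h \<cong>\<^sub>p m"
proof -
  have "h' \<star> h \<star> m \<star> (h' \<star> h) \<cong>\<^sub>p mat_id \<star> m \<star> mat_id"
    using assms unfolding inverse_pair_def by (intro mat_cong_mul) auto
  then show ?thesis by (simp add: mat_mul_assoc)
qed

lemma scalar_unimodular:
  assumes "scalar_mat m" "unimodular m"
  shows "proj m = proj mat_id"
proof -
  obtain k where k: "m \<cong>\<^sub>p mat_scale k mat_id" using assms(1) scalar_mat_iff by blast
  from mat_cong_det[OF this] assms(2) have "[k * k = 1] (mod P)"
    by simp (metis cong_sym cong_trans)
  then have "P dvd (k - 1) * (k + 1)" by (simp add: cong_iff_dvd_diff algebra_simps)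
  then have "[k = 1] (mod P) \<or> [k = -1] (mod P)"
    unfolding P_dvd_mult by (simp add: cong_iff_dvd_diff)
  then have "m \<cong>\<^sub>p mat_id \<or> m \<cong>\<^sub>p mat_scale (-1) mat_id"
    using mat_cong_scale[of k 1 mat_id mat_id] mat_cong_scale[of k "-1" mat_id mat_id] k
      mat_cong_trans by (metis mat_cong_refl mat_scale_1)
  then show ?thesis using proj_eq_iff by blast
qed

lemma scalar_iff_proj:
  assumes "unimodular m"
  shows "proj m = proj mat_id \<longleftrightarrow> scalar_mat m"
proof
  assume "proj m = proj mat_id"
  then have "m \<cong>\<^sub>p mat_id \<or> m \<cong>\<^sub>p mat_scale (-1) mat_id" by (simp only: proj_eq_iff)
  then show "scalar_mat m" unfolding scalar_mat_iff by (metis mat_scale_1)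
qed (use assms scalar_unimodular in blast)

definition companion :: "int \<Rightarrow> int_mat"
  where "companion t = (0, - 1, 1, t)"

text \<open>
  In a basis \<open>v, mv\<close> the matrix \<open>m\<close> becomes its companion matrix by the Cayley-Hamilton theorem. Such
  a basis exists because the two unit vectors and their sum cannot all be eigenvectors of a nonscalar
  matrix.
\<close>

lemma conj_companion:
  assumes "unimodular m" "\<not> scalar_mat m" "[mat_tr m = t] (mod P)"
  obtains h h' where "inverse_pair h h'" "m \<cong>\<^sub>p h \<star> companion t \<star> h'"
proof -
  obtain a b c d where m: "m = (a, b, c, d)" by (cases m)
  define h where "h x y = (x, a * x + b * y, y, c * x + d * y)" for x y
  have mh: "m \<star> h x y \<cong>\<^sub>p h x y \<star> companion t" for x y
  proof -
    have "m \<star> h x y = h x y \<star> (0, - mat_det m, 1, mat_tr m)"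
      by (simp add: h_def m algebra_simps)
    also have "\<dots> \<cong>\<^sub>p h x y \<star> companion t"
      using assms by (intro mat_cong_mul) (auto simp: companion_def cong_minus_minus_iff)
    finally show ?thesis .
  qed
  obtain x y where "\<not> P dvd mat_det (h x y)"
  proof -
    have "mat_det (h 1 0) = c" "mat_det (h 0 1) = - b" "mat_det (h 1 1) = c + d - a - b"
      by (simp_all add: h_def algebra_simps)
    moreover have "\<not> P dvd c \<or> \<not> P dvd (-b) \<or> \<not> P dvd (c + d - a - b)"
    proof (rule ccontr)
      assume "\<not> ?thesis"
      then have *: "P dvd c" "P dvd b" "P dvd c + d - a - b" by auto
      from dvd_diff[OF dvd_diff[OF *(1,2)] *(3)] have "P dvd a - d"
        by (simp add: algebra_simps)
      with * assms(2) show False by (simp add: m cong_iff_dvd_diff)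
    qed
    ultimately show thesis using that by metis
  qed
  then obtain h' where h': "inverse_pair (h x y) h'" using ex_inverse_pair by blast
  have "m \<star> (h x y \<star> h') \<cong>\<^sub>p m \<star> mat_id"
    using h' unfolding inverse_pair_def by (intro mat_cong_mul) auto
  then have "m \<cong>\<^sub>p m \<star> h x y \<star> h'" by (simp add: mat_mul_assoc mat_cong_sym)
  also have "\<dots> \<cong>\<^sub>p h x y \<star> companion t \<star> h'" by (intro mat_cong_mul mh mat_cong_refl)
  finally show thesis using h' that by blast
qed

lemma companion_conj:
  assumes "unimodular m" "\<not> scalar_mat m" "unimodular n" "\<not> scalar_mat n"
    and "[mat_tr m = mat_tr n] (mod P)"
  obtains h h' where "inverse_pair h h'" "n \<cong>\<^sub>p h \<star> m \<star> h'"
proof -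
  obtain h h' where h: "inverse_pair h h'" "m \<cong>\<^sub>p h \<star> companion (mat_tr n) \<star> h'"
    using conj_companion[OF assms(1,2,5)] .
  obtain k k' where k: "inverse_pair k k'" "n \<cong>\<^sub>p k \<star> companion (mat_tr n) \<star> k'"
    using conj_companion[OF assms(3,4) cong_refl] .
  have "h' \<star> m \<star> h \<cong>\<^sub>p h' \<star> (h \<star> companion (mat_tr n) \<star> h') \<star> h"
    by (intro mat_cong_mul h mat_cong_refl)
  also have "\<dots> \<cong>\<^sub>p companion (mat_tr n)" by (rule conj_undo[OF h(1)])
  finally have "companion (mat_tr n) \<cong>\<^sub>p h' \<star> m \<star> h" by (rule mat_cong_sym)
  then have "k \<star> companion (mat_tr n) \<star> k' \<cong>\<^sub>p k \<star> (h' \<star> m \<star> h) \<star> k'"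
    by (intro mat_cong_mul mat_cong_refl)
  with k(2) have "n \<cong>\<^sub>p (k \<star> h') \<star> m \<star> (h \<star> k')"
    by (metis mat_cong_trans mat_mul_assoc)
  with inverse_pair_mul[OF k(1) inverse_pair_sym[OF h(1)]] show thesis by (rule that)
qed

end

section \<open>Products of classes with prescribed traces\<close>

context psl2_prime begin

text \<open>
  Conjugation by a matrix of GL(2,p) with inverse \<open>h'\<close>. Among these are automorphisms of PSL(2,p)
  that are not inner; they are needed to fuse the two classes of transvections.
\<close>

definition conj_map :: "int_mat \<Rightarrow> int_mat \<Rightarrow> int_mat set \<Rightarrow> int_mat set"
  where "conj_map h h' X = proj (h \<star> (SOME m. unimodular m \<and> X = proj m) \<star> h')"

lemma conj_map_proj:
  assumes "unimodular m"
  shows "conj_map h h' (proj m) = proj (h \<star> m \<star> h')"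
proof -
  define n where "n = (SOME n. unimodular n \<and> proj m = proj n)"
  have "proj m = proj n"
    unfolding n_def using someI[of "\<lambda>n. unimodular n \<and> proj m = proj n"] assms by metis
  then have "n \<cong>\<^sub>p m \<or> n \<cong>\<^sub>p mat_scale (-1) m" by (metis proj_eq_iff)
  then have "h \<star> n \<star> h' \<cong>\<^sub>p h \<star> m \<star> h' \<or> h \<star> n \<star> h' \<cong>\<^sub>p h \<star> mat_scale (-1) m \<star> h'"
    by (meson mat_cong_mul mat_cong_refl)
  then have "proj (h \<star> n \<star> h') = proj (h \<star> m \<star> h')"
    unfolding mat_mul_scale mat_scale_mul by (metis proj_eq_iff)
  then show ?thesis by (simp add: conj_map_def n_def)
qed

lemma conj_map_hom:
  assumes h: "inverse_pair h h'"
  shows "conj_map h h' \<in> hom PSL PSL"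
proof (rule homI)
  fix x assume "x \<in> carrier PSL"
  then show "conj_map h h' x \<in> carrier PSL"
    using unimodular_conj[OF h] by (auto simp only: PSL_carrier conj_map_proj)
  fix y assume "y \<in> carrier PSL"
  with \<open>x \<in> carrier PSL\<close> obtain m n where x: "x = proj m" "unimodular m" and y: "y = proj n" "unimodular n"
    unfolding PSL_carrier by blast
  have "h \<star> (m \<star> n) \<star> h' \<cong>\<^sub>p (h \<star> m \<star> h') \<star> (h \<star> n \<star> h')"
    using mat_cong_cancel[of h' h "h \<star> m" "n \<star> h'"] h
    unfolding inverse_pair_def by (simp add: mat_mul_assoc mat_cong_sym)
  then show "conj_map h h' (x \<otimes>\<^bsub>PSL\<^esub> y) = conj_map h h' x \<otimes>\<^bsub>PSL\<^esub> conj_map h h' y"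
    by (simp only: x y PSL_mult conj_map_proj unimodular_mul unimodular_conj[OF h] proj_cong)
qed

text \<open>
  Scalar matrices are excepted because the class of the identity has the same trace 2 as the
  transvections. As a matrix and its negative represent the same element, \<open>t\<close> matters up to sign only.
\<close>

definition contains_trace :: "int_mat set set \<Rightarrow> int \<Rightarrow> bool"
  where "contains_trace X t \<longleftrightarrow> proj mat_id \<in> X \<and>
    (\<forall>n. unimodular n \<and> \<not> scalar_mat n \<and> [mat_tr n = t] (mod P) \<longrightarrow> proj n \<in> X)"

lemma contains_trace_minus:
  assumes "contains_trace X t"
  shows "contains_trace X (- t)"
  unfolding contains_trace_def
proof (intro conjI allI impI)
  show "proj mat_id \<in> X" using assms by (simp add: contains_trace_def)
next
  fix n assume n: "unimodular n \<and> \<not> scalar_mat n \<and> [mat_tr n = - t] (mod P)"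
  let ?m = "mat_scale (-1) n"
  have "unimodular ?m" using n unimodular_minus by blast
  moreover have "\<not> scalar_mat ?m"
    using n by (cases n) (auto simp: cong_minus_minus_iff cong_0_iff)
  moreover have "[mat_tr ?m = t] (mod P)"
    using n cong_minus_minus_iff[of "mat_tr n" "-t" P] by (simp only: mat_tr_scale) simp
  ultimately have "proj ?m \<in> X" using assms unfolding contains_trace_def by blast
  then show "proj n \<in> X" by (simp only: proj_minus)
qed

lemma contains_trace_if_invariant:
  assumes "proj mat_id \<in> X"
    and inv: "\<And>h h' m. inverse_pair h h' \<Longrightarrow> unimodular m \<Longrightarrow> proj m \<in> X \<Longrightarrow> proj (h \<star> m \<star> h') \<in> X"
    and m: "proj m \<in> X" "unimodular m" "\<not> scalar_mat m"
  shows "contains_trace X (mat_tr m)"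
  unfolding contains_trace_def
proof (intro conjI allI impI assms(1))
  fix n assume n: "unimodular n \<and> \<not> scalar_mat n \<and> [mat_tr n = mat_tr m] (mod P)"
  then obtain h h' where h: "inverse_pair h h'" "n \<cong>\<^sub>p h \<star> m \<star> h'"
    using companion_conj[OF m(2,3), of n] cong_sym[of "mat_tr n"] by blast
  show "proj n \<in> X" unfolding proj_cong[OF h(2)] by (rule inv[OF h(1) m(2,1)])
qed

lemma odd_p: "odd p"
  using prime_odd_nat[OF prime_p] p_ge_5 by simp

text \<open>
  Pigeonhole: both sides take \<open>(p+1)/2\<close> values modulo \<open>p\<close>, already on \<open>0, ..., (p-1)/2\<close>.
\<close>

lemma ex_square_difference:
  assumes "\<not> P dvd \<kappa>"
  shows "\<exists>u s. [u ^ 2 - \<delta> = \<kappa> * s ^ 2] (mod P)"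
proof -
  define T where "T = {0..(P - 1) div 2}"
  define f where "f u = (u ^ 2 - \<delta>) mod P" for u
  define g where "g s = (\<kappa> * s ^ 2) mod P" for s
  have odd: "odd P" using odd_p by simp
  have inj: "x = y" if "x \<in> T" "y \<in> T" "P dvd x ^ 2 - y ^ 2" for x y
  proof -
    have "P dvd (x - y) * (x + y)" using that(3) by (simp add: algebra_simps power2_eq_square)
    then consider "P dvd x - y" | "P dvd x + y" using P_dvd_mult by blast
    then show ?thesis
    proof cases
      case 1
      moreover have "\<bar>x - y\<bar> < \<bar>P\<bar>" using that(1,2) P_ge_5 unfolding T_def atLeastAtMost_iff by linarith
      ultimately show ?thesis using dvd_imp_le_int[of "x - y" P] by force
    next
      case 2
      moreover have "\<bar>x + y\<bar> < \<bar>P\<bar>" using that(1,2) P_ge_5 unfolding T_def atLeastAtMost_iff by linarith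
      ultimately have "x + y = 0" using dvd_imp_le_int[of "x + y" P] by force
      with that(1,2) show ?thesis by (simp add: T_def)
    qed
  qed
  have "inj_on f T"
    by (intro inj_onI inj) (auto simp: f_def mod_eq_dvd_iff)
  moreover have "inj_on g T"
  proof (intro inj_onI inj)
    fix x y assume "g x = g y"
    then have "P dvd \<kappa> * (x ^ 2 - y ^ 2)" by (simp add: g_def mod_eq_dvd_iff algebra_simps)
    with assms show "P dvd x ^ 2 - y ^ 2" by (simp add: P_dvd_mult)
  qed
  moreover have "card T = (p + 1) div 2" using odd by (auto simp: T_def elim!: oddE)
  ultimately have card: "card (f ` T) = (p + 1) div 2" "card (g ` T) = (p + 1) div 2"
    by (simp_all add: card_image)
  have fin: "finite (f ` T)" "finite (g ` T)" by (simp_all add: T_def)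
  have "f ` T \<union> g ` T \<subseteq> {0..<P}" using P_ge_5 by (auto simp: f_def g_def)
  then have "card (f ` T \<union> g ` T) \<le> p" using card_mono[of "{0..<P}"] by fastforce
  moreover have "(p + 1) div 2 + (p + 1) div 2 = p + 1" using odd_p by presburger
  ultimately have "f ` T \<inter> g ` T \<noteq> {}"
    using card_Un_disjoint[OF fin] card by auto
  then show ?thesis by (auto simp: f_def g_def cong_def)
qed

lemma not_dvd_small: "0 < k \<Longrightarrow> k < 5 \<Longrightarrow> \<not> P dvd k"
  using P_ge_5 zdvd_imp_le[of P k] by auto

lemma not_dvd_2: "\<not> P dvd 2" and not_dvd_4: "\<not> P dvd 4"
  by (intro not_dvd_small; simp)+

lemma quadratic_takes_square:
  assumes "\<not> P dvd \<alpha> \<or> \<not> P dvd \<beta> \<or> (\<exists>s. [\<gamma> = s ^ 2] (mod P))"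
  shows "\<exists>b s. [\<alpha> * b ^ 2 + \<beta> * b + \<gamma> = s ^ 2] (mod P)"
proof -
  \<comment> \<open>If \<open>\<alpha> \<noteq> 0\<close>, completing the square leads to a difference of squares; a linear polynomial
    takes every value.\<close>
  consider "\<not> P dvd \<alpha>" | "P dvd \<alpha>" "\<not> P dvd \<beta>" | s where "[\<gamma> = s ^ 2] (mod P)"
    using assms by blast
  then show ?thesis
  proof cases
    case 1
    then have n: "\<not> P dvd 4 * \<alpha>" "\<not> P dvd 2 * \<alpha>"
      using not_dvd_4 not_dvd_2 by (auto simp: P_dvd_mult)
    obtain u s where us: "[u ^ 2 - (\<beta> ^ 2 - 4 * \<alpha> * \<gamma>) = 4 * \<alpha> * s ^ 2] (mod P)"
      using ex_square_difference[OF n(1)] by blast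
    obtain l where l: "[2 * \<alpha> * l = 1] (mod P)" using ex_inverse_mod[OF n(2)] by blast
    define b where "b = l * (u - \<beta>)"
    have "[2 * \<alpha> * l * (u - \<beta>) + \<beta> = 1 * (u - \<beta>) + \<beta>] (mod P)"
      by (intro cong_add cong_mult l cong_refl)
    then have "[2 * \<alpha> * b + \<beta> = u] (mod P)" by (simp add: b_def mult.assoc)
    then have "[(2 * \<alpha> * b + \<beta>) ^ 2 - (\<beta> ^ 2 - 4 * \<alpha> * \<gamma>) = u ^ 2 - (\<beta> ^ 2 - 4 * \<alpha> * \<gamma>)] (mod P)"
      by (intro cong_diff cong_pow cong_refl)
    also note us
    finally have "P dvd (4 * \<alpha>) * (\<alpha> * b ^ 2 + \<beta> * b + \<gamma> - s ^ 2)"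
      by (simp add: cong_iff_dvd_diff power2_eq_square algebra_simps)
    with n(1) have "P dvd \<alpha> * b ^ 2 + \<beta> * b + \<gamma> - s ^ 2" unfolding P_dvd_mult[of "4 * \<alpha>"] by blast
    then show ?thesis unfolding cong_iff_dvd_diff by blast
  next
    case 2
    then obtain l where l: "[\<beta> * l = 1] (mod P)" using ex_inverse_mod by blast
    have "[\<alpha> * (- \<gamma> * l) ^ 2 + (\<beta> * l) * (- \<gamma>) + \<gamma> = 0 * (- \<gamma> * l) ^ 2 + 1 * (- \<gamma>) + \<gamma>] (mod P)"
      using 2 by (intro cong_add cong_mult l cong_refl) (simp add: cong_0_iff)
    then have "[\<alpha> * (- \<gamma> * l) ^ 2 + \<beta> * (- \<gamma> * l) + \<gamma> = 0 ^ 2] (mod P)"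
      by (simp add: mult.commute mult.left_commute)
    then show ?thesis by blast
  next
    case 3
    then have "[\<alpha> * 0 ^ 2 + \<beta> * 0 + \<gamma> = s ^ 2] (mod P)" by simp
    then show ?thesis by blast
  qed
qed

text \<open>
  With \<open>m = (a, b, c, t - a)\<close>, the two trace conditions leave \<open>c = s - ar + b\<close>, and the determinant
  condition becomes a quadratic equation for \<open>a\<close> whose discriminant is the polynomial in \<open>b\<close> of
  \<open>quadratic_takes_square\<close>.
\<close>

lemma companion_factor:
  assumes "\<not> P dvd r ^ 2 - 4 \<or> \<not> P dvd 2 * r * t - 4 * s \<or> (\<exists>z. [t ^ 2 - 4 = z ^ 2] (mod P))"
  obtains m where "unimodular m" "[mat_tr m = t] (mod P)"
    "[mat_tr (mat_adj m \<star> companion r) = s] (mod P)"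
proof -
  have "\<exists>b z. [(r ^ 2 - 4) * b ^ 2 + (2 * r * t - 4 * s) * b + (t ^ 2 - 4) = z ^ 2] (mod P)"
    using assms by (intro quadratic_takes_square) auto
  then obtain b z where z: "P dvd (r ^ 2 - 4) * b ^ 2 + (2 * r * t - 4 * s) * b + (t ^ 2 - 4) - z ^ 2"
    unfolding cong_iff_dvd_diff by blast
  obtain l where "[2 * l = 1] (mod P)" using ex_inverse_mod[OF not_dvd_2] by blast
  then have l: "P dvd 2 * l - 1" by (simp add: cong_iff_dvd_diff)
  \<comment> \<open>The factor \<open>l\<close> is the inverse of 2, so this is the quadratic formula.\<close>
  define a where "a = l * (r * b + t + z)"
  have a: "P dvd 2 * a - (r * b + t + z)"
    using dvd_mult2[OF l, of "r * b + t + z"] by (simp add: a_def algebra_simps)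
  define c where "c = s - a * r + b"
  let ?e = "a * (t - a) - b * c - 1"
  have "4 * ?e = - (2 * a - (r * b + t + z)) * (2 * a - (r * b + t) + z)
     + ((r ^ 2 - 4) * b ^ 2 + (2 * r * t - 4 * s) * b + (t ^ 2 - 4) - z ^ 2)"
    by (simp add: c_def algebra_simps power2_eq_square)
  then have "P dvd 4 * ?e" using a z by (metis dvd_add dvd_minus_iff dvd_mult2)
  then have "P dvd ?e" using not_dvd_4 P_dvd_mult[of 4] by blast
  then have "unimodular (a, b, c, t - a)" by (simp add: cong_iff_dvd_diff)
  moreover have "[mat_tr (a, b, c, t - a) = t] (mod P)" by simp
  moreover have "[mat_tr (mat_adj (a, b, c, t - a) \<star> companion r) = s] (mod P)"
    by (simp add: c_def companion_def algebra_simps)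
  ultimately show thesis by (rule that)
qed

lemma proj_in_set_mult:
  assumes "proj m \<in> X" "proj n \<in> Y" "unimodular m" "unimodular n" "k \<cong>\<^sub>p m \<star> n"
  shows "proj k \<in> X <#>\<^bsub>PSL\<^esub> Y"
  using assms PSL_mult[of m n] proj_cong[of k "m \<star> n"] unfolding set_mult_def by auto

lemma unimodular_cong: "m \<cong>\<^sub>p n \<Longrightarrow> unimodular m \<longleftrightarrow> unimodular n"
  using mat_cong_det cong_trans cong_sym by meson

text \<open>
  If one of the two factors found happens to be scalar, it represents the identity, which
  \<open>contains_trace\<close> puts into the set as well.
\<close>

lemma product_generic:
  assumes X: "contains_trace X t" and Y: "contains_trace Y s"
    and g: "unimodular g" "\<not> scalar_mat g" "[mat_tr g = r] (mod P)"
    and solv: "\<not> P dvd r ^ 2 - 4 \<or> \<not> P dvd 2 * r * t - 4 * s \<or> (\<exists>z. [t ^ 2 - 4 = z ^ 2] (mod P))"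
  shows "proj g \<in> X <#>\<^bsub>PSL\<^esub> Y"
proof -
  obtain h h' where h: "inverse_pair h h'" "g \<cong>\<^sub>p h \<star> companion r \<star> h'"
    using conj_companion[OF g] .
  obtain m where m: "unimodular m" "[mat_tr m = t] (mod P)"
    "[mat_tr (mat_adj m \<star> companion r) = s] (mod P)"
    using companion_factor[OF solv] .
  let ?n = "mat_adj m \<star> companion r"
  have n: "unimodular ?n" using m(1) by (intro unimodular_mul) (simp_all add: companion_def)
  have split: "companion r \<cong>\<^sub>p m \<star> ?n"
    using mat_cong_cancel[of m "mat_adj m" mat_id "companion r"] unimodular_inverse_pair[OF m(1)]
    unfolding inverse_pair_def by (simp add: mat_cong_sym)
  have gmn: "g \<cong>\<^sub>p (h \<star> m \<star> h') \<star> (h \<star> ?n \<star> h')"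
  proof -
    note h(2)
    also have "h \<star> companion r \<star> h' \<cong>\<^sub>p h \<star> (m \<star> ?n) \<star> h'"
      by (intro mat_cong_mul split mat_cong_refl)
    also have "\<dots> = (h \<star> m) \<star> (?n \<star> h')" by (simp only: mat_mul_assoc)
    also have "\<dots> \<cong>\<^sub>p (h \<star> m \<star> h') \<star> (h \<star> (?n \<star> h'))"
      using h(1) mat_cong_cancel[of h' h] unfolding inverse_pair_def
      by (intro mat_cong_sym[OF mat_cong_cancel[of h' h "h \<star> m", unfolded]]) simp
    finally show ?thesis by (simp only: mat_mul_assoc)
  qed
  note um = unimodular_conj[OF h(1) m(1)] and un = unimodular_conj[OF h(1) n]
  have tm: "[mat_tr (h \<star> m \<star> h') = t] (mod P)" and tn: "[mat_tr (h \<star> ?n \<star> h') = s] (mod P)"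
    using mat_tr_conj[OF h(1)] m cong_trans by blast+
  have in_set: "proj n \<in> Z" if "contains_trace Z u" "unimodular n" "[mat_tr n = u] (mod P)" for Z u n
    using that scalar_iff_proj[of n] unfolding contains_trace_def by metis
  show ?thesis
    using in_set[OF X um tm] in_set[OF Y un tn] um un gmn by (rule proj_in_set_mult)
qed

lemma contains_trace_set_mult:
  assumes X: "contains_trace X t" and Y: "contains_trace Y s" and r: "\<not> P dvd r ^ 2 - 4"
  shows "contains_trace (X <#>\<^bsub>PSL\<^esub> Y) r"
proof -
  have "proj mat_id \<in> X <#>\<^bsub>PSL\<^esub> Y"
    using X Y by (intro proj_in_set_mult[of mat_id _ mat_id]) (auto simp: contains_trace_def)
  then show ?thesis
    unfolding contains_trace_def using product_generic[OF X Y _ _ _ disjI1[OF r]] by blast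
qed

lemma neg_one_square_iff: "(\<exists>z. [- 1 = z ^ 2] (mod P)) \<longleftrightarrow> [p = 1] (mod 4)"
proof -
  have leg: "[Legendre (- 1) P = (- 1) ^ ((p - 1) div 2)] (mod P)"
    using prime_p p_ge_5 by (intro euler_criterion) auto
  have Q: "(\<exists>z. [- 1 = z ^ 2] (mod P)) \<longleftrightarrow> QuadRes P (- 1)"
    unfolding QuadRes_def by (metis cong_sym)
  have n0: "\<not> [- 1 = 0] (mod P)" using P_ge_5 by (simp add: cong_iff_dvd_diff)
  have n1: "\<not> [1 = - 1] (mod P)" "\<not> [- 1 = 1] (mod P)"
    using not_dvd_2 by (simp_all add: cong_iff_dvd_diff)
  have "p mod 4 = 1 \<or> p mod 4 = 3" using odd_p by presburger
  then show ?thesis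
  proof
    assume p: "p mod 4 = 1"
    then have "even ((p - 1) div 2)" by presburger
    with leg n0 n1 p show ?thesis unfolding Q by (auto simp: Legendre_def cong_def split: if_splits)
  next
    assume p: "p mod 4 = 3"
    then have "odd ((p - 1) div 2)" by presburger
    with leg n0 n1 p show ?thesis unfolding Q by (auto simp: Legendre_def cong_def split: if_splits)
  qed
qed

text \<open>
  If neither \<open>(t, s)\<close> nor \<open>(t, -s)\<close> admits a factorization by \<open>product_generic\<close>, then \<open>r^2 = 4\<close> and
  \<open>2rt = 4s = -4s\<close>, so that \<open>t = s = 0\<close>. The polynomial is then the constant \<open>-4\<close>.
\<close>

lemma product_covers:
  assumes X: "contains_trace X t" and Y: "contains_trace Y s"
    and ts: "\<not> P dvd t \<or> \<not> P dvd s \<or> [p = 1] (mod 4)"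
  shows "carrier PSL \<subseteq> X <#>\<^bsub>PSL\<^esub> Y"
proof
  fix x assume "x \<in> carrier PSL"
  then obtain g where g: "x = proj g" "unimodular g" by (auto simp only: PSL_carrier)
  define r where "r = mat_tr g"
  show "x \<in> X <#>\<^bsub>PSL\<^esub> Y"
  proof (cases "scalar_mat g")
    case True
    have x: "x = proj mat_id" unfolding g(1) by (rule scalar_unimodular[OF True g(2)])
    have "contains_trace (X <#>\<^bsub>PSL\<^esub> Y) 0"
      using not_dvd_4 by (intro contains_trace_set_mult[OF X Y]) simp
    then show ?thesis unfolding x contains_trace_def by blast
  next
    case False
    note * = g(2) False cong_refl[of "mat_tr g" P]
    consider "\<not> P dvd 2 * r * t - 4 * s" | "\<not> P dvd 2 * r * t - 4 * (- s)"
      | "\<not> P dvd r ^ 2 - 4" | "P dvd r ^ 2 - 4" "P dvd 2 * r * t - 4 * s" "P dvd 2 * r * t - 4 * (- s)"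
      by blast
    then show ?thesis
    proof cases
      case 1
      then show ?thesis using product_generic[OF X Y *] by (simp add: g r_def)
    next
      case 2
      then show ?thesis using product_generic[OF X contains_trace_minus[OF Y] *] by (simp add: g r_def)
    next
      case 3
      then show ?thesis using product_generic[OF X Y *] by (simp add: g r_def)
    next
      case 4
      have "P dvd 8 * s" "P dvd 4 * (r * t)"
        using dvd_diff[OF 4(3,2)] dvd_add[OF 4(2,3)] by simp_all
      moreover have "\<not> P dvd 8" using not_dvd_2 not_dvd_4 P_dvd_mult[of 2 4] by simp
      ultimately have s: "P dvd s" and rt: "P dvd r * t"
        using not_dvd_4 P_dvd_mult[of 8 s] P_dvd_mult[of 4] by blast+
      moreover have "\<not> P dvd r"
        using 4(1) not_dvd_4 dvd_diff_right_iff[of P "r ^ 2" 4] by (auto simp: power2_eq_square)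
      ultimately have t: "P dvd t" using P_dvd_mult by blast
      with s ts obtain z where z: "[- 1 = z ^ 2] (mod P)" using neg_one_square_iff by blast
      have "[t * t - 4 = 0 * t + 4 * (- 1)] (mod P)"
        using t by (simp add: cong_iff_dvd_diff)
      also have "[0 * t + 4 * (- 1) = 0 * t + 4 * z ^ 2] (mod P)"
        by (intro cong_add cong_mult z cong_refl)
      finally have "[t ^ 2 - 4 = (2 * z) ^ 2] (mod P)" by (simp add: power2_eq_square)
      then show ?thesis using product_generic[OF X Y *] unfolding g(1) by blast
    qed
  qed
qed

end

section \<open>Simplicity of PSL(2,p)\<close>

context psl2_prime begin

definition upper :: "int \<Rightarrow> int_mat" where "upper x = (1, x, 0, 1)"
definition lower :: "int \<Rightarrow> int_mat" where "lower x = (1, 0, x, 1)"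

lemma unimodular_upper: "unimodular (upper x)" and unimodular_lower: "unimodular (lower x)"
  by (simp_all add: upper_def lower_def)

lemma upper_not_scalar: "\<not> scalar_mat (upper 1)"
  using not_dvd_small[of 1] by (auto simp: upper_def cong_iff_dvd_diff)

text \<open>
  The upper right entry is determined by the others as soon as the lower left one is invertible.
\<close>

lemma cong_entry_from_det:
  assumes "\<not> P dvd c" "[a = a'] (mod P)" "[c = c'] (mod P)" "[d = d'] (mod P)"
    and "unimodular (a, b, c, d)" "unimodular (a', b', c', d')"
  shows "(a, b, c, d) \<cong>\<^sub>p (a', b', c', d')"
proof -
  have "[c * b = a * d - 1] (mod P)"
    using cong_diff[OF cong_refl[of "a * d"] assms(5)] by (simp add: mult.commute)
  also have "[a * d - 1 = a' * d' - 1] (mod P)"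
    using assms by (intro cong_diff cong_mult cong_refl)
  also have "[a' * d' - 1 = c' * b'] (mod P)"
    using cong_diff[OF cong_refl[of "a' * d'"] assms(6)] by (simp add: mult.commute cong_sym)
  also have "[c' * b' = c * b'] (mod P)"
    using assms by (intro cong_mult cong_refl) (simp add: cong_sym)
  finally have "P dvd c * (b - b')" by (simp add: cong_iff_dvd_diff algebra_simps)
  with assms(1) have "[b = b'] (mod P)" unfolding P_dvd_mult cong_iff_dvd_diff by blast
  with assms show ?thesis by simp
qed

lemma PSL_inv:
  assumes "unimodular m"
  shows "inv\<^bsub>PSL\<^esub> proj m = proj (mat_adj m)"
proof (rule group.inv_equality[OF group_PSL])
  have u: "unimodular (mat_adj m)" using assms by simp
  then show "proj m \<in> carrier PSL" "proj (mat_adj m) \<in> carrier PSL"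
    using assms unfolding PSL_carrier by blast+
  have "mat_adj m \<star> m \<cong>\<^sub>p mat_id"
    using unimodular_inverse_pair[OF assms] unfolding inverse_pair_def by blast
  then show "proj (mat_adj m) \<otimes>\<^bsub>PSL\<^esub> proj m = \<one>\<^bsub>PSL\<^esub>"
    unfolding PSL_mult[OF u assms] PSL_one by (rule proj_cong)
qed

context
  fixes N :: "int_mat set set"
  assumes N: "N \<lhd> PSL"
begin

text \<open>
  The lemmas about this preimage of the normal subgroup lead from an arbitrary nonscalar matrix in it
  to a transvection, and from there to all matrices of determinant 1.
\<close>

definition lifts :: "int_mat \<Rightarrow> bool" where "lifts m \<longleftrightarrow> unimodular m \<and> proj m \<in> N"

lemma lifts_mul: "lifts m \<Longrightarrow> lifts n \<Longrightarrow> lifts (m \<star> n)"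
  using subgroup.m_closed[OF normal_imp_subgroup[OF N], of "proj m" "proj n"]
  unfolding lifts_def by (simp only: unimodular_mul PSL_mult)

lemma lifts_adj: "lifts m \<Longrightarrow> lifts (mat_adj m)"
  using subgroup.m_inv_closed[OF normal_imp_subgroup[OF N], of "proj m"]
  unfolding lifts_def by (simp add: PSL_inv)

lemma lifts_conj:
  assumes "unimodular h" "lifts m"
  shows "lifts (h \<star> m \<star> mat_adj h)"
proof -
  have "proj h \<in> carrier PSL" using assms(1) unfolding PSL_carrier by blast
  then have "proj h \<otimes>\<^bsub>PSL\<^esub> proj m \<otimes>\<^bsub>PSL\<^esub> inv\<^bsub>PSL\<^esub> proj h \<in> N"
    using assms(2) unfolding lifts_def by (intro normal.inv_op_closed2[OF N]) auto
  then show ?thesis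
    using assms unfolding lifts_def by (simp add: PSL_inv PSL_mult unimodular_mul)
qed

lemma lifts_cong: "lifts m \<Longrightarrow> n \<cong>\<^sub>p m \<Longrightarrow> lifts n"
  unfolding lifts_def using proj_cong unimodular_cong by metis

lemma lifts_minus: "lifts m \<Longrightarrow> lifts (mat_scale (-1) m)"
  unfolding lifts_def proj_minus using unimodular_minus by blast

lemma lifts_corner:
  assumes "lifts m" "\<not> scalar_mat m"
  obtains a b c d where "lifts (a, b, c, d)" "\<not> P dvd c"
proof -
  obtain a b c d where m: "m = (a, b, c, d)" by (cases m)
  have "lifts (lower 1 \<star> m \<star> mat_adj (lower 1))"
    using assms(1) by (intro lifts_conj) (simp_all add: lower_def)
  then have 1: "lifts (a - b, b, a + c - b - d, b + d)"
    by (simp add: m lower_def algebra_simps)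
  have "lifts ((0, 1, -1, 0) \<star> m \<star> mat_adj (0, 1, -1, 0))"
    using assms(1) by (intro lifts_conj) simp_all
  then have 2: "lifts (d, - c, - b, a)" by (simp add: m)
  have "\<not> P dvd c \<or> \<not> P dvd - b \<or> \<not> P dvd a + c - b - d"
  proof (rule ccontr)
    assume "\<not> ?thesis"
    then have *: "P dvd c" "P dvd b" "P dvd a + c - b - d" by auto
    from dvd_add[OF dvd_diff[OF *(2,1)] *(3)] have "P dvd a - d"
      by (simp add: algebra_simps)
    with * assms(2) show False by (simp add: m cong_iff_dvd_diff)
  qed
  with that 1 2 assms(1) m show thesis by metis
qed

text \<open>
  The commutator of a matrix of determinant 1 with the transvection \<open>upper s\<close> has trace
  \<open>2 + s^2c^2\<close>, where \<open>c\<close> is the lower left entry; the choice \<open>s = 1/c\<close> gives 3, which is nonzero as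
  \<open>p \<ge> 5\<close>.
\<close>

lemma lifts_corner_trace:
  assumes "lifts (a, b, c, d)" "\<not> P dvd c"
  obtains a b c d where "lifts (a, b, c, d)" "\<not> P dvd c" "\<not> P dvd a + d"
proof -
  define m where "m = (a, b, c, d)"
  obtain s where s: "[c * s = 1] (mod P)" using ex_inverse_mod assms(2) by blast
  have m: "lifts m" using assms by (simp add: m_def)
  define n where "n = m \<star> (upper s \<star> mat_adj m \<star> mat_adj (upper s))"
  have n: "lifts n"
    unfolding n_def by (intro lifts_mul lifts_conj lifts_adj m unimodular_upper)
  obtain a' b' c' d' where n_eq: "n = (a', b', c', d')" by (cases n)
  have tr: "a' + d' = 2 * mat_det m + (c * s) * (c * s)" and c': "c' = - (c * s) * c"
    using n_eq by (auto simp: n_def m_def upper_def algebra_simps)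
  have "[a' + d' = 2 * 1 + 1 * 1] (mod P)"
    using m unfolding tr lifts_def by (intro cong_add cong_mult s cong_refl) blast
  then have "\<not> P dvd a' + d'" using not_dvd_small[of 3] cong_dvd_iff by fastforce
  moreover have "\<not> P dvd c * s" using s prime_P cong_dvd_iff not_prime_unit by blast
  then have "\<not> P dvd c'" using assms(2) unfolding c' by (simp add: P_dvd_mult)
  ultimately show thesis using n n_eq that by blast
qed

text \<open>
  For a matrix \<open>m\<close> of determinant 1 and trace \<open>t\<close>, the product of \<open>m\<close> with its conjugate by
  \<open>upper s\<close> has trace \<open>t^2 - 2 - s^2c^2\<close>, which is \<open>-2\<close> for \<open>s = t/c\<close>; the
  negative of such a matrix represents the same element and has
  trace 2.
\<close>

lemma lifts_trace_2:
  assumes "lifts (a, b, c, d)" "\<not> P dvd c" "\<not> P dvd a + d"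
  obtains a b c d where "lifts (a, b, c, d)" "\<not> P dvd c" "[a + d = 2] (mod P)"
proof -
  define m where "m = (a, b, c, d)"
  obtain l where l: "[c * l = 1] (mod P)" using ex_inverse_mod assms(2) by blast
  define s where "s = l * (a + d)"
  have "[c * l * (a + d) = 1 * (a + d)] (mod P)" by (intro cong_mult l cong_refl)
  then have s: "[c * s = a + d] (mod P)" by (simp add: s_def mult.assoc)
  have m: "lifts m" using assms by (simp add: m_def)
  define n where "n = mat_scale (-1) (m \<star> (upper s \<star> m \<star> mat_adj (upper s)))"
  have n: "lifts n"
    unfolding n_def by (intro lifts_minus lifts_mul lifts_conj m unimodular_upper)
  obtain a' b' c' d' where n_eq: "n = (a', b', c', d')" by (cases n)
  have tr: "a' + d' = 2 * mat_det m + ((c * s) * (c * s) - (a + d) * (a + d))"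
    and c': "c' = - (c * (a + d + c * s))"
    using n_eq by (auto simp: n_def m_def upper_def algebra_simps)
  have "[a' + d' = 2 * 1 + ((a + d) * (a + d) - (a + d) * (a + d))] (mod P)"
    using m unfolding tr lifts_def by (intro cong_add cong_diff cong_mult s cong_refl) blast
  moreover have "[a + d + c * s = (a + d) + (a + d)] (mod P)" by (intro cong_add s cong_refl)
  then have "[a + d + c * s = 2 * (a + d)] (mod P)" by simp
  then have "\<not> P dvd a + d + c * s"
    using assms(3) not_dvd_2 P_dvd_mult cong_dvd_iff by blast
  then have "\<not> P dvd c'" unfolding c' dvd_minus_iff P_dvd_mult using assms(2) by blast
  ultimately show thesis using n n_eq that by auto
qed

text \<open>
  A matrix of determinant 1 and trace 2 with lower left entry \<open>c \<noteq> 0\<close> is conjugate to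
  \<open>lower c\<close> by some \<open>upper x\<close>. The powers of \<open>lower c\<close> are all lower transvections because
  the field has prime order, and a quarter turn conjugates these to the upper ones.
\<close>

lemma lifts_lower:
  assumes "lifts (a, b, c, d)" "\<not> P dvd c" "[a + d = 2] (mod P)"
  shows "lifts (lower y)" "lifts (upper y)"
proof -
  obtain l where l: "[c * l = 1] (mod P)" using ex_inverse_mod assms(2) by blast
  define x where "x = l * (1 - a)"
  have "[c * l * (1 - a) = 1 * (1 - a)] (mod P)" by (intro cong_mult l cong_refl)
  then have x: "[c * x = 1 - a] (mod P)" by (simp add: x_def mult.assoc)
  define n where "n = upper x \<star> (a, b, c, d) \<star> mat_adj (upper x)"
  have n: "lifts n" unfolding n_def by (intro lifts_conj assms unimodular_upper)
  define b' where "b' = b + x * d - x * (a + x * c)"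
  have n_eq: "n = (a + c * x, b', c, d - c * x)"
    unfolding b'_def by (simp add: n_def upper_def algebra_simps)
  have e1: "[1 = a + c * x] (mod P)" using cong_add[OF cong_refl[of a] x] by (simp add: cong_sym)
  have "[d - c * x = d - (1 - a)] (mod P)" by (intro cong_diff x cong_refl)
  also have "[d - (1 - a) = 2 - 1] (mod P)"
    using cong_diff[OF assms(3) cong_refl[of 1]] by (simp add: algebra_simps)
  finally have e2: "[1 = d - c * x] (mod P)" by (simp add: cong_sym)
  have "lower c \<cong>\<^sub>p n"
    using n e1 e2 assms(2) unfolding lower_def n_eq lifts_def
    by (intro cong_entry_from_det) auto
  with n have c: "lifts (lower c)" by (rule lifts_cong)
  have mult: "lifts (lower (of_nat k * c))" for k
  proof (induction k)
    case 0
    have "lifts (lower c \<star> mat_adj (lower c))" by (intro lifts_mul lifts_adj c)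
    then show ?case by (simp add: lower_def)
  next
    case (Suc k)
    from lifts_mul[OF Suc c] show ?case by (simp add: lower_def algebra_simps)
  qed
  have lower: "lifts (lower y)" for y
  proof -
    define k where "k = nat ((y * l) mod P)"
    have "[of_nat k * c = y * l * c] (mod P)"
      using P_ge_5 by (intro cong_mult) (auto simp: k_def cong_def)
    also have "[y * l * c = y * 1] (mod P)"
      using cong_mult[OF cong_refl[of y] l] by (simp add: algebra_simps)
    finally have "lower y \<cong>\<^sub>p lower (of_nat k * c)" by (simp add: lower_def cong_sym)
    with mult show ?thesis by (rule lifts_cong)
  qed
  then show "lifts (lower y)" .
  have "lifts ((0, 1, -1, 0) \<star> lower (-y) \<star> mat_adj (0, 1, -1, 0))"
    by (intro lifts_conj lower) simp
  then show "lifts (upper y)" by (simp add: lower_def upper_def)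
qed

text \<open>
  A matrix with invertible lower left entry is of the form \<open>upper x \<star> lower c \<star> upper y\<close>.
\<close>

lemma lifts_all_corner:
  assumes "\<And>y. lifts (lower y)" "\<And>y. lifts (upper y)"
    and "unimodular (a, b, c, d)" "\<not> P dvd c"
  shows "lifts (a, b, c, d)"
proof -
  obtain l where l: "[c * l = 1] (mod P)" using ex_inverse_mod assms(4) by blast
  define n where "n = upper ((a - 1) * l) \<star> lower c \<star> upper ((d - 1) * l)"
  have n: "lifts n" unfolding n_def by (intro lifts_mul assms)
  define b' where "b' = (1 + (a - 1) * l * c) * ((d - 1) * l) + (a - 1) * l"
  have n_eq: "n = (1 + (a - 1) * (c * l), b', c, 1 + (d - 1) * (c * l))"
    unfolding b'_def by (simp add: n_def upper_def lower_def algebra_simps)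
  have "[1 + (x - 1) * (c * l) = 1 + (x - 1) * 1] (mod P)" for x
    by (intro cong_add cong_mult l cong_refl)
  then have e: "[x = 1 + (x - 1) * (c * l)] (mod P)" for x by (simp add: cong_sym)
  have "(a, b, c, d) \<cong>\<^sub>p n"
    using n assms unfolding n_eq lifts_def
    by (intro cong_entry_from_det e) auto
  with n show ?thesis by (rule lifts_cong)
qed

lemma normal_subgroup_trivial: "N = carrier PSL \<or> N = {\<one>\<^bsub>PSL\<^esub>}"
proof (cases "\<exists>m. lifts m \<and> \<not> scalar_mat m")
  case False
  have "x = \<one>\<^bsub>PSL\<^esub>" if "x \<in> N" for x
  proof -
    have "x \<in> carrier PSL" using that normal_imp_subgroup[OF N] subgroup.subset by blast
    then obtain m where "x = proj m" "unimodular m" unfolding PSL_carrier by blast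
    with that False show ?thesis
      unfolding lifts_def PSL_one using scalar_unimodular by blast
  qed
  then show ?thesis using subgroup.one_closed[OF normal_imp_subgroup[OF N]] by blast
next
  case True
  then have gen: "lifts (lower y)" "lifts (upper y)" for y
    by (metis lifts_corner lifts_corner_trace lifts_trace_2 lifts_lower)+
  have "lifts m" if m: "unimodular m" for m
  proof -
    obtain a b c d where m_eq: "m = (a, b, c, d)" by (cases m)
    show ?thesis
    proof (cases "P dvd c")
      case False
      with lifts_all_corner[OF gen] m show ?thesis by (simp add: m_eq)
    next
      case True
      have "\<not> P dvd a"
      proof
        assume "P dvd a"
        with True have "P dvd mat_det m" by (simp add: m_eq)
        with m show False using prime_P cong_dvd_iff not_prime_unit by blast
      qed
      with True have "\<not> P dvd a + c" by (simp add: dvd_add_left_iff)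
      moreover have "unimodular (lower 1 \<star> m)" by (intro unimodular_mul unimodular_lower m)
      ultimately have "lifts (lower 1 \<star> m)"
        using lifts_all_corner[OF gen] by (simp add: m_eq lower_def)
      from lifts_mul[OF gen(1)[of "-1"] this] show ?thesis by (simp add: m_eq lower_def)
    qed
  qed
  then have "carrier PSL \<subseteq> N" unfolding PSL_carrier lifts_def by blast
  then show ?thesis using normal_imp_subgroup[OF N] subgroup.subset by blast
qed

end

lemma finite_simple_PSL: "finite_simple_nonab_group PSL"
proof -
  interpret G: group PSL by (rule group_PSL)
  have nc: "proj (upper 1) \<otimes>\<^bsub>PSL\<^esub> proj (lower 1) \<noteq> proj (lower 1) \<otimes>\<^bsub>PSL\<^esub> proj (upper 1)"
  proof
    assume "proj (upper 1) \<otimes>\<^bsub>PSL\<^esub> proj (lower 1) = proj (lower 1) \<otimes>\<^bsub>PSL\<^esub> proj (upper 1)"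
    then have "P dvd 1 \<or> P dvd 2"
      unfolding PSL_mult[OF unimodular_upper unimodular_lower] PSL_mult[OF unimodular_lower unimodular_upper]
        proj_eq_iff
      by (auto simp: upper_def lower_def cong_iff_dvd_diff)
    then show False using not_dvd_2 not_dvd_small[of 1] by auto
  qed
  have in_car: "proj (upper 1) \<in> carrier PSL" "proj (lower 1) \<in> carrier PSL"
    using unimodular_upper unimodular_lower unfolding PSL_carrier by blast+
  have "\<not> comm_group PSL"
    using nc in_car comm_monoid.m_comm[OF comm_group.axioms(1)] by fastforce
  moreover have "simple_group PSL"
  proof
    have "proj (upper 1) \<noteq> \<one>\<^bsub>PSL\<^esub>" using nc in_car by auto
    then have "card {proj (upper 1), \<one>\<^bsub>PSL\<^esub>} = 2" by simp
    moreover have "card {proj (upper 1), \<one>\<^bsub>PSL\<^esub>} \<le> card (carrier PSL)"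
      by (intro card_mono finite_PSL) (use in_car in auto)
    ultimately show "1 < order PSL" by (simp add: order_def)
  qed (rule normal_subgroup_trivial)
  ultimately show ?thesis unfolding finite_simple_nonab_group_def using finite_PSL by blast
qed

end

section \<open>Homomorphisms from simple groups without involutions to PSL(2,p)\<close>

definition involution_free :: "('a, 'b) monoid_scheme \<Rightarrow> bool"
  where "involution_free H \<longleftrightarrow> (\<forall>x \<in> carrier H. x \<otimes>\<^bsub>H\<^esub> x = \<one>\<^bsub>H\<^esub> \<longrightarrow> x = \<one>\<^bsub>H\<^esub>)"

context psl2_prime begin

fun affine_mat :: "int \<Rightarrow> int \<Rightarrow> int_mat \<Rightarrow> int_mat" where
  "affine_mat k l (a, b, c, d) = (k + l * a, l * b, l * c, k + l * d)"

lemma ratio_cong: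
  assumes "[u * l = 1] (mod P)" "[u * v' = u' * v] (mod P)"
  shows "[v' = v * l * u'] (mod P)"
proof -
  have "[1 * v' = u * l * v'] (mod P)" using assms(1) by (intro cong_mult cong_refl) (rule cong_sym)
  also have "u * l * v' = l * (u * v')" by simp
  also have "[l * (u * v') = l * (u' * v)] (mod P)" by (intro cong_mult assms cong_refl)
  finally show ?thesis by (simp add: mult.commute mult.left_commute)
qed

text \<open>
  A matrix that commutes with a nonscalar \<open>g\<close> is a polynomial in \<open>g\<close>: commuting says that the vectors
  formed by \<open>b\<close>, \<open>c\<close> and \<open>a - d\<close> are proportional for the two matrices.
\<close>

lemma commuting_affine:
  assumes "\<not> scalar_mat g" "x \<star> g \<cong>\<^sub>p g \<star> x"
  obtains k l where "x \<cong>\<^sub>p affine_mat k l g"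
proof -
  obtain a b c d where g: "g = (a, b, c, d)" by (cases g)
  obtain a' b' c' d' where x: "x = (a', b', c', d')" by (cases x)
  have e: "P dvd b' * c - b * c'" "P dvd (a - d) * b' - (a' - d') * b" "P dvd (a - d) * c' - (a' - d') * c"
    using assms(2) by (auto simp: g x cong_iff_dvd_diff algebra_simps dvd_diff_commute)
  have "\<exists>l. [b' = l * b] (mod P) \<and> [c' = l * c] (mod P) \<and> [a' - d' = l * (a - d)] (mod P)"
  proof -
    consider "\<not> P dvd b" | "\<not> P dvd c" | "\<not> P dvd a - d"
      using assms(1) by (auto simp: g cong_0_iff cong_iff_dvd_diff)
    then show ?thesis
    proof cases
      case 1
      then obtain i where i: "[b * i = 1] (mod P)" using ex_inverse_mod by blast
      show ?thesis
        by (rule exI[of _ "b' * i"], intro conjI; rule ratio_cong[OF i])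
          (use e in \<open>simp_all add: cong_iff_dvd_diff algebra_simps dvd_diff_commute\<close>)
    next
      case 2
      then obtain i where i: "[c * i = 1] (mod P)" using ex_inverse_mod by blast
      show ?thesis
        by (rule exI[of _ "c' * i"], intro conjI; rule ratio_cong[OF i])
          (use e in \<open>simp_all add: cong_iff_dvd_diff algebra_simps dvd_diff_commute\<close>)
    next
      case 3
      then obtain i where i: "[(a - d) * i = 1] (mod P)" using ex_inverse_mod by blast
      show ?thesis
        by (rule exI[of _ "(a' - d') * i"], intro conjI; rule ratio_cong[OF i])
          (use e in \<open>simp_all add: cong_iff_dvd_diff algebra_simps dvd_diff_commute\<close>)
    qed
  qed
  then obtain l where l: "[b' = l * b] (mod P)" "[c' = l * c] (mod P)" "[a' - d' = l * (a - d)] (mod P)"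
    by blast
  have "x \<cong>\<^sub>p affine_mat (a' - l * a) l g"
    using l by (simp add: g x cong_iff_dvd_diff algebra_simps dvd_diff_commute)
  then show thesis by (rule that)
qed

lemma affine_mat_cong:
  "[k = k'] (mod P) \<Longrightarrow> [l = l'] (mod P) \<Longrightarrow> affine_mat k l g \<cong>\<^sub>p affine_mat k' l' g"
  by (cases g) (auto intro!: cong_add cong_mult)

lemma affine_mat_commute: "affine_mat k l g \<star> affine_mat k' l' g = affine_mat k' l' g \<star> affine_mat k l g"
  by (cases g) (simp add: algebra_simps)

lemma commuting_mats_commute:
  assumes "\<not> scalar_mat g" "x \<star> g \<cong>\<^sub>p g \<star> x" "y \<star> g \<cong>\<^sub>p g \<star> y"
  shows "x \<star> y \<cong>\<^sub>p y \<star> x"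
proof -
  obtain k l where x: "x \<cong>\<^sub>p affine_mat k l g" using commuting_affine assms(1,2) .
  obtain k' l' where y: "y \<cong>\<^sub>p affine_mat k' l' g" using commuting_affine assms(1,3) .
  from mat_cong_mul[OF x y] mat_cong_mul[OF y x] show ?thesis
    by (metis affine_mat_commute mat_cong_sym mat_cong_trans)
qed

text \<open>
  By the Cayley-Hamilton theorem \<open>m^2 = (tr m) m - 1\<close>. So the involutions of PSL(2,p) are
  the classes of trace 0.
\<close>

lemma proj_square:
  assumes "unimodular m"
  shows "proj m \<otimes>\<^bsub>PSL\<^esub> proj m = \<one>\<^bsub>PSL\<^esub> \<longleftrightarrow> scalar_mat m \<or> P dvd mat_tr m"
proof -
  obtain a b c d where m: "m = (a, b, c, d)" by (cases m)
  have det: "P dvd a * d - b * c - 1" using assms by (simp add: m cong_iff_dvd_diff)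
  have "proj m \<otimes>\<^bsub>PSL\<^esub> proj m = \<one>\<^bsub>PSL\<^esub> \<longleftrightarrow> scalar_mat (m \<star> m)"
    unfolding PSL_mult[OF assms assms] PSL_one using scalar_iff_proj unimodular_mul assms by blast
  also have "\<dots> \<longleftrightarrow> P dvd (a + d) * b \<and> P dvd (a + d) * c \<and> P dvd (a + d) * (a - d)"
    by (simp add: m cong_iff_dvd_diff algebra_simps)
  also have "\<dots> \<longleftrightarrow> scalar_mat m \<or> P dvd mat_tr m"
    unfolding P_dvd_mult by (auto simp: m cong_iff_dvd_diff)
  finally show ?thesis .
qed

lemma scalar_trace_nonzero:
  assumes "unimodular m" "scalar_mat m"
  shows "\<not> P dvd mat_tr m"
proof
  assume t: "P dvd mat_tr m"
  have "m \<cong>\<^sub>p mat_id \<or> m \<cong>\<^sub>p mat_scale (-1) mat_id"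
    using scalar_unimodular[OF assms(2,1)] unfolding proj_eq_iff .
  then have "[mat_tr m = 2] (mod P) \<or> [mat_tr m = - 2] (mod P)"
    using mat_cong_tr by fastforce
  with t have "P dvd 2" using cong_dvd_iff by fastforce
  with not_dvd_2 show False by blast
qed

text \<open>
  The hypotheses say that \<open>k + lg\<close> has the trace \<open>t\<close> and the determinant 1 of \<open>g\<close>. If \<open>g\<close> has distinct
  eigenvalues, the conclusion is that it equals \<open>g\<close> or \<open>t - g = inv g\<close>.
\<close>

lemma conj_trace_det:
  assumes "\<not> P dvd t ^ 2 - 4" "[2 * k + l * t = t] (mod P)" "[k ^ 2 + k * l * t + l ^ 2 = 1] (mod P)"
  shows "[l = 1] (mod P) \<and> [k = 0] (mod P) \<or> [l = - 1] (mod P) \<and> [k = t] (mod P)"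
proof -
  have e1: "P dvd 2 * k + l * t - t" and e2: "P dvd k ^ 2 + k * l * t + l ^ 2 - 1"
    using assms by (simp_all add: cong_iff_dvd_diff)
  have "(t ^ 2 - 4) * ((l - 1) * (l + 1)) =
    (2 * k + l * t - t) * (2 * k + l * t + t) - 4 * (k ^ 2 + k * l * t + l ^ 2 - 1)"
    by (simp add: algebra_simps power2_eq_square)
  also have "P dvd \<dots>" using e1 e2 by (intro dvd_diff dvd_mult2[OF e1] dvd_mult[OF e2])
  finally have "P dvd l - 1 \<or> P dvd l + 1" using assms(1) P_dvd_mult by blast
  then show ?thesis
  proof
    assume l: "P dvd l - 1"
    have "P dvd 2 * k" using dvd_diff[OF e1 dvd_mult2[OF l, of t]] by (simp add: algebra_simps)
    with l not_dvd_2 show ?thesis by (simp add: P_dvd_mult cong_0_iff cong_iff_dvd_diff)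
  next
    assume l: "P dvd l + 1"
    have "P dvd 2 * (k - t)" using dvd_diff[OF e1 dvd_mult2[OF l, of t]] by (simp add: algebra_simps)
    then have "P dvd k - t" using not_dvd_2 P_dvd_mult[of 2] by blast
    with l show ?thesis by (simp add: cong_iff_dvd_diff)
  qed
qed

context
  fixes H :: "('h, 'k) monoid_scheme" and \<phi> :: "'h \<Rightarrow> int_mat set"
  assumes H: "simple_group H" and inv_free: "involution_free H"
    and hom: "\<phi> \<in> hom H PSL" and nontriv: "\<exists>x \<in> carrier H. \<phi> x \<noteq> \<one>\<^bsub>PSL\<^esub>"
begin

interpretation H: simple_group H by (rule H)
interpretation G: group PSL by (rule group_PSL)
interpretation \<phi>: group_hom H PSL \<phi> by unfold_locales (rule hom)

lemma hom_inj: "inj_on \<phi> (carrier H)"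
proof -
  have "kernel H PSL \<phi> \<noteq> carrier H" using nontriv by (auto simp: kernel_def)
  then have "kernel H PSL \<phi> = {\<one>\<^bsub>H\<^esub>}"
    using H.no_real_normal_subgroup[OF \<phi>.normal_kernel] by blast
  then show ?thesis by (rule \<phi>.trivial_ker_imp_inj)
qed

lemma ex_lift: "x \<in> carrier H \<Longrightarrow> \<exists>m. unimodular m \<and> \<phi> x = proj m"
  using \<phi>.hom_closed[of x] unfolding PSL_carrier by blast

lemma lift_scalar_iff:
  assumes "x \<in> carrier H" "unimodular m" "\<phi> x = proj m"
  shows "scalar_mat m \<longleftrightarrow> x = \<one>\<^bsub>H\<^esub>"
  using assms scalar_iff_proj[OF assms(2)] PSL_one \<phi>.hom_one hom_inj inj_on_eq_iff H.one_closed
  by metis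

lemma lift_trace:
  assumes "x \<in> carrier H" "unimodular m" "\<phi> x = proj m"
  shows "\<not> P dvd mat_tr m"
proof
  assume t: "P dvd mat_tr m"
  have "\<phi> (x \<otimes>\<^bsub>H\<^esub> x) = \<one>\<^bsub>PSL\<^esub>"
    using proj_square[OF assms(2)] t assms by simp
  then have "x \<otimes>\<^bsub>H\<^esub> x = \<one>\<^bsub>H\<^esub>"
    using hom_inj assms(1) \<phi>.hom_one by (metis H.m_closed H.one_closed inj_on_eq_iff)
  then have "x = \<one>\<^bsub>H\<^esub>" using inv_free assms(1) unfolding involution_free_def by blast
  then have "scalar_mat m" using lift_scalar_iff[OF assms] by blast
  with t assms(2) scalar_trace_nonzero show False by blast
qed

lemma lift_mult:
  assumes "x \<in> carrier H" "unimodular m" "\<phi> x = proj m" "y \<in> carrier H" "unimodular n" "\<phi> y = proj n"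
  shows "\<phi> (x \<otimes>\<^bsub>H\<^esub> y) = proj (m \<star> n)"
  unfolding \<phi>.hom_mult[OF assms(1,4)] assms(3,6) by (rule PSL_mult[OF assms(2,5)])

lemma lift_inv:
  assumes "x \<in> carrier H" "unimodular m" "\<phi> x = proj m"
  shows "\<phi> (inv\<^bsub>H\<^esub> x) = proj (mat_adj m)"
  unfolding \<phi>.hom_inv[OF assms(1)] assms(3) by (rule PSL_inv[OF assms(2)])

text \<open>
  If the images commute in PSL(2,p), the matrices commute up to sign. The sign \<open>-1\<close> would give
  \<open>m n (inv m) = -n\<close>, so that \<open>n\<close> has trace 0 and represents an involution.
\<close>

lemma lift_commute_iff:
  assumes "x \<in> carrier H" "unimodular m" "\<phi> x = proj m"
    and "y \<in> carrier H" "unimodular n" "\<phi> y = proj n"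
  shows "x \<otimes>\<^bsub>H\<^esub> y = y \<otimes>\<^bsub>H\<^esub> x \<longleftrightarrow> m \<star> n \<cong>\<^sub>p n \<star> m"
proof -
  have xy: "\<phi> (x \<otimes>\<^bsub>H\<^esub> y) = proj (m \<star> n)" "\<phi> (y \<otimes>\<^bsub>H\<^esub> x) = proj (n \<star> m)"
    using assms lift_mult by blast+
  have "x \<otimes>\<^bsub>H\<^esub> y = y \<otimes>\<^bsub>H\<^esub> x \<longleftrightarrow> \<phi> (x \<otimes>\<^bsub>H\<^esub> y) = \<phi> (y \<otimes>\<^bsub>H\<^esub> x)"
    using hom_inj assms(1,4) H.m_closed by (metis inj_on_eq_iff)
  also have "\<dots> \<longleftrightarrow> proj (m \<star> n) = proj (n \<star> m)" unfolding xy ..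
  also have "\<dots> \<longleftrightarrow> m \<star> n \<cong>\<^sub>p n \<star> m"
  proof -
    have False if "m \<star> n \<cong>\<^sub>p mat_scale (-1) (n \<star> m)"
    proof -
      note pair = unimodular_inverse_pair[OF assms(2)]
      have id: "mat_adj m \<star> m \<cong>\<^sub>p mat_id" using pair by (simp add: inverse_pair_def)
      have "m \<star> n \<star> mat_adj m \<cong>\<^sub>p mat_scale (-1) (n \<star> m) \<star> mat_adj m"
        by (intro mat_cong_mul that mat_cong_refl)
      from mat_cong_tr[OF this] mat_tr_conj[OF pair, of n]
      have "[mat_tr n = mat_tr (mat_scale (-1) (n \<star> m) \<star> mat_adj m)] (mod P)"
        by (meson cong_sym cong_trans)
      also have "mat_tr (mat_scale (-1) (n \<star> m) \<star> mat_adj m) = - (mat_tr n * mat_det m)"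
        by (simp add: mat_scale_mul mat_mul_assoc mat_mul_adj mat_mul_scale mat_tr_scale
            del: mat_scale.simps mat_mul.simps)
      also have "[- (mat_tr n * mat_det m) = - (mat_tr n * 1)] (mod P)"
        unfolding cong_minus_minus_iff by (intro cong_mult assms cong_refl)
      finally have "P dvd 2 * mat_tr n" by (simp add: cong_iff_dvd_diff)
      then show False using not_dvd_2 lift_trace[OF assms(4-6)] P_dvd_mult by blast
    qed
    then show ?thesis unfolding proj_eq_iff by blast
  qed
  finally show ?thesis .
qed

lemma lift_commutation_transitive: "H.commutation_transitive"
  unfolding H.commutation_transitive_def
proof (intro ballI)
  fix g x y assume g: "g \<in> carrier H - {\<one>\<^bsub>H\<^esub>}" and x: "x \<in> H.centralizer g" and y: "y \<in> H.centralizer g"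
  then have car: "g \<in> carrier H" "x \<in> carrier H" "y \<in> carrier H" by (auto simp: H.centralizer_def)
  obtain a where a: "unimodular a" "\<phi> g = proj a" using ex_lift car(1) by blast
  obtain m where m: "unimodular m" "\<phi> x = proj m" using ex_lift car(2) by blast
  obtain n where n: "unimodular n" "\<phi> y = proj n" using ex_lift car(3) by blast
  have "\<not> scalar_mat a" using lift_scalar_iff[OF car(1) a] g by blast
  moreover have "m \<star> a \<cong>\<^sub>p a \<star> m"
    using x lift_commute_iff[OF car(2) m car(1) a] by (simp add: H.centralizer_def)
  moreover have "n \<star> a \<cong>\<^sub>p a \<star> n"
    using y lift_commute_iff[OF car(3) n car(1) a] by (simp add: H.centralizer_def)
  ultimately have "m \<star> n \<cong>\<^sub>p n \<star> m" by (rule commuting_mats_commute)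
  then show "x \<otimes>\<^bsub>H\<^esub> y = y \<otimes>\<^bsub>H\<^esub> x" using lift_commute_iff[OF car(2) m car(3) n] by blast
qed

lemma lift_conj:
  assumes "x \<in> carrier H" "unimodular m" "\<phi> x = proj m" "y \<in> carrier H" "unimodular n" "\<phi> y = proj n"
  shows "\<phi> (x \<otimes>\<^bsub>H\<^esub> y \<otimes>\<^bsub>H\<^esub> inv\<^bsub>H\<^esub> x) = proj (m \<star> n \<star> mat_adj m)"
proof -
  have "unimodular (mat_adj m)" using assms(2) by simp
  then show ?thesis
    using lift_mult[OF _ unimodular_mul[OF assms(2,5)] lift_mult[OF assms] _ _ lift_inv[OF assms(1-3)]]
      assms(1,4) by blast
qed

text \<open>
  The conjugate of \<open>g\<close> by \<open>x\<close> is a polynomial in \<open>g\<close> with the same trace and determinant, hence \<open>g\<close> or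
  \<open>inv g\<close>. If it is \<open>inv g\<close>, then \<open>x^2\<close> commutes with \<open>g\<close> and with \<open>x\<close>; as \<open>x\<close> is not an involution,
  transitivity shows that \<open>x\<close> and \<open>g\<close> commute after all.
\<close>

lemma lift_self_normalizing:
  assumes g: "g \<in> carrier H" "g \<noteq> \<one>\<^bsub>H\<^esub>" "unimodular a" "\<phi> g = proj a" "\<not> P dvd mat_tr a ^ 2 - 4"
    and x: "x \<in> carrier H" "x \<otimes>\<^bsub>H\<^esub> g \<otimes>\<^bsub>H\<^esub> inv\<^bsub>H\<^esub> x \<in> H.centralizer g"
  shows "x \<in> H.centralizer g"
proof -
  let ?y = "x \<otimes>\<^bsub>H\<^esub> g \<otimes>\<^bsub>H\<^esub> inv\<^bsub>H\<^esub> x"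
  let ?t = "mat_tr a"
  have yH: "?y \<in> carrier H" using g x by simp
  obtain m where m: "unimodular m" "\<phi> x = proj m" using ex_lift x(1) by blast
  define b where "b = m \<star> a \<star> mat_adj m"
  have pair: "inverse_pair m (mat_adj m)" by (rule unimodular_inverse_pair[OF m(1)])
  have b: "unimodular b" unfolding b_def by (rule unimodular_conj[OF pair g(3)])
  have yb: "\<phi> ?y = proj b" unfolding b_def by (rule lift_conj[OF x(1) m g(1,3,4)])
  have tb: "[mat_tr b = ?t] (mod P)" unfolding b_def by (rule mat_tr_conj[OF pair])
  have "\<not> scalar_mat a" using lift_scalar_iff[OF g(1,3,4)] g(2) by blast
  moreover have "b \<star> a \<cong>\<^sub>p a \<star> b"
    using x(2) lift_commute_iff[OF yH b yb g(1,3,4)] by (simp add: H.centralizer_def)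
  ultimately obtain k l where kl: "b \<cong>\<^sub>p affine_mat k l a" by (rule commuting_affine)
  have aff: "mat_tr (affine_mat k l a) = 2 * k + l * ?t"
    "mat_det (affine_mat k l a) = k ^ 2 + k * l * ?t + l ^ 2 * mat_det a"
    by (cases a; simp add: algebra_simps power2_eq_square)+
  have "[2 * k + l * ?t = ?t] (mod P)"
    using cong_trans[OF cong_sym[OF mat_cong_tr[OF kl]] tb] unfolding aff .
  moreover have "[k ^ 2 + k * l * ?t + l ^ 2 = 1] (mod P)"
  proof -
    have "[k ^ 2 + k * l * ?t + l ^ 2 * 1 = k ^ 2 + k * l * ?t + l ^ 2 * mat_det a] (mod P)"
      using g(3) by (intro cong_add cong_mult cong_refl) (rule cong_sym)
    also have "[k ^ 2 + k * l * ?t + l ^ 2 * mat_det a = 1] (mod P)"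
      using cong_trans[OF cong_sym[OF mat_cong_det[OF kl]] b] unfolding aff .
    finally show ?thesis by simp
  qed
  ultimately consider "[l = 1] (mod P)" "[k = 0] (mod P)" | "[l = - 1] (mod P)" "[k = ?t] (mod P)"
    using conj_trace_det[OF g(5)] by blast
  then show ?thesis
  proof cases
    case 1
    have "affine_mat k l a \<cong>\<^sub>p affine_mat 0 1 a" using 1 by (intro affine_mat_cong)
    also have "affine_mat 0 1 a = a" by (cases a) simp
    finally have "proj b = proj a" using kl proj_cong mat_cong_trans by blast
    then have "?y = g" using yb g hom_inj yH by (metis inj_on_eq_iff)
    then have "x \<otimes>\<^bsub>H\<^esub> g = g \<otimes>\<^bsub>H\<^esub> x" using H.conj_eq_iff_commute x(1) g(1) by blast
    then show ?thesis using x by (simp add: H.centralizer_def)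
  next
    case 2
    have "affine_mat k l a \<cong>\<^sub>p affine_mat ?t (- 1) a" using 2 by (intro affine_mat_cong)
    also have "affine_mat ?t (- 1) a = mat_adj a" by (cases a) simp
    finally have "proj b = proj (mat_adj a)" using kl proj_cong mat_cong_trans by blast
    then have y: "?y = inv\<^bsub>H\<^esub> g"
      using yb lift_inv[OF g(1,3,4)] hom_inj yH g(1) by (metis H.inv_closed inj_on_eq_iff)
    have sq: "x \<otimes>\<^bsub>H\<^esub> x \<in> H.centralizer g" by (rule H.square_in_centralizer_if_inverts[OF x(1) g(1) y])
    show ?thesis
    proof (cases "x = \<one>\<^bsub>H\<^esub>")
      case True
      then show ?thesis using g by (simp add: H.centralizer_def)
    next
      case False
      then have nz: "x \<otimes>\<^bsub>H\<^esub> x \<noteq> \<one>\<^bsub>H\<^esub>" using inv_free x(1) unfolding involution_free_def by blast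
      have xx: "x \<otimes>\<^bsub>H\<^esub> x \<in> carrier H" using x(1) by simp
      have "x \<in> H.centralizer (x \<otimes>\<^bsub>H\<^esub> x)" by (rule H.in_centralizer_square[OF x(1)])
      with H.centralizer_sym[OF sq g(1)] show ?thesis
        using H.centralizer_trans[OF lift_commutation_transitive xx nz] by blast
    qed
  qed
qed

text \<open>
  The powers of \<open>g\<close> are all transvections \<open>upper k\<close>. If a conjugate of \<open>g\<close> had lower left entry
  \<open>c \<noteq> 0\<close>, its product with \<open>upper k\<close> would have trace \<open>2 + kc\<close>, which is 0 for some \<open>k\<close>,
  against the absence of involutions. So \<open>c = 0\<close>,
  and the conjugate, which has trace 2, commutes with \<open>g\<close>.
\<close>

lemma commutative_if_unipotent:
  assumes g: "g \<in> carrier H" "\<phi> g = proj (upper 1)"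
    and xy: "x \<in> carrier H" "y \<in> carrier H"
  shows "x \<otimes>\<^bsub>H\<^esub> y = y \<otimes>\<^bsub>H\<^esub> x"
proof (rule H.commutative_if_conjugates_commute[OF lift_commutation_transitive g(1) _ _ xy])
  show "g \<noteq> \<one>\<^bsub>H\<^esub>" using upper_not_scalar lift_scalar_iff[OF g(1) unimodular_upper g(2)] by blast
  have power: "\<exists>z \<in> carrier H. \<phi> z = proj (upper (int n))" for n
  proof (induction n)
    case 0
    show ?case using \<phi>.hom_one by (intro bexI[of _ "\<one>\<^bsub>H\<^esub>"]) (simp_all add: PSL_one upper_def)
  next
    case (Suc n)
    then obtain z where z: "z \<in> carrier H" "\<phi> z = proj (upper (int n))" by blast
    have "\<phi> (z \<otimes>\<^bsub>H\<^esub> g) = proj (upper (int n) \<star> upper 1)"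
      by (rule lift_mult) (use z g unimodular_upper in auto)
    also have "upper (int n) \<star> upper 1 = upper (int (Suc n))" by (simp add: upper_def)
    finally show ?case using z g by blast
  qed
  fix x assume x: "x \<in> carrier H"
  let ?y = "x \<otimes>\<^bsub>H\<^esub> g \<otimes>\<^bsub>H\<^esub> inv\<^bsub>H\<^esub> x"
  have yH: "?y \<in> carrier H" using g x by simp
  obtain m where m: "unimodular m" "\<phi> x = proj m" using ex_lift x by blast
  define b where "b = m \<star> upper 1 \<star> mat_adj m"
  have pair: "inverse_pair m (mat_adj m)" by (rule unimodular_inverse_pair[OF m(1)])
  have b: "unimodular b" unfolding b_def by (rule unimodular_conj[OF pair unimodular_upper])
  have yb: "\<phi> ?y = proj b" unfolding b_def by (rule lift_conj[OF x m g(1) unimodular_upper g(2)])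
  have tb: "[mat_tr b = 2] (mod P)"
    using mat_tr_conj[OF pair, of "upper 1"] unfolding b_def by (simp add: upper_def)
  obtain a' b' c' d' where b_eq: "b = (a', b', c', d')" by (cases b)
  have c: "P dvd c'"
  proof (rule ccontr)
    assume "\<not> P dvd c'"
    then obtain l where l: "[c' * l = 1] (mod P)" using ex_inverse_mod by blast
    define n where "n = nat ((- 2 * l) mod P)"
    obtain z where z: "z \<in> carrier H" "\<phi> z = proj (upper (int n))" using power by blast
    have "\<phi> (z \<otimes>\<^bsub>H\<^esub> ?y) = proj (upper (int n) \<star> b)"
      by (rule lift_mult[OF z(1) unimodular_upper z(2) yH b yb])
    then have "\<not> P dvd mat_tr (upper (int n) \<star> b)"
      using lift_trace z(1) yH unimodular_mul[OF unimodular_upper b] by blast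
    moreover have "mat_tr (upper (int n) \<star> b) = mat_tr b + int n * c'"
      by (simp add: upper_def b_eq)
    moreover have n: "[mat_tr b + int n * c' = 2 + (- 2 * l) * c'] (mod P)"
      using P_ge_5 by (intro cong_add cong_mult tb cong_refl) (simp add: n_def cong_def)
    moreover have "[2 + - 2 * (c' * l) = 2 + - 2 * 1] (mod P)"
      by (intro cong_add cong_mult l cong_refl)
    then have "P dvd 2 + (- 2 * l) * c'" by (simp add: cong_0_iff algebra_simps)
    ultimately show False using cong_dvd_iff[OF n] by simp
  qed
  have "P dvd a' * d' - b' * c' - 1" and t: "P dvd a' + d' - 2"
    using b tb by (simp_all add: b_eq cong_iff_dvd_diff)
  then have "P dvd a' * (a' + d' - 2) - (a' * d' - b' * c' - 1) - b' * c'"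
    using c by (meson dvd_diff dvd_mult)
  then have "P dvd (a' - 1) * (a' - 1)" by (simp add: algebra_simps)
  then have a: "P dvd a' - 1" using P_dvd_mult by blast
  have d: "P dvd a' - d'" using dvd_diff[OF dvd_mult[OF a, of 2] t] by (simp add: algebra_simps)
  have "b \<star> upper 1 \<cong>\<^sub>p upper 1 \<star> b"
    using c d by (simp add: b_eq upper_def cong_iff_dvd_diff)
  then show "?y \<in> H.centralizer g"
    using lift_commute_iff[OF yH b yb g(1) unimodular_upper g(2)] yH by (simp add: H.centralizer_def)
qed

end

text \<open>
  An element of trace \<open>\<plusminus> 2\<close> other than the identity is a transvection up to sign and
  conjugation by GL(2,p), so in that case \<open>commutative_if_unipotent\<close> applies to the given
  homomorphism followed by a suitable conjugation.
\<close>

lemma odd_simple_hom_trivial: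
  assumes H: "finite_simple_nonab_group H" "involution_free H" and hom: "\<phi> \<in> hom H PSL"
    and x: "x \<in> carrier H"
  shows "\<phi> x = \<one>\<^bsub>PSL\<^esub>"
proof (rule ccontr)
  assume nt: "\<phi> x \<noteq> \<one>\<^bsub>PSL\<^esub>"
  have S: "simple_group H" and fin: "finite (carrier H)" and nc: "\<not> comm_group H"
    using H(1) by (auto simp: finite_simple_nonab_group_def)
  interpret H: simple_group H by (rule S)
  have nt': "\<exists>x\<in>carrier H. \<phi> x \<noteq> \<one>\<^bsub>PSL\<^esub>" using nt x by blast
  note facts = S H(2) hom nt'
  have abelian: "comm_group H" if "\<And>x y. x \<in> carrier H \<Longrightarrow> y \<in> carrier H \<Longrightarrow> x \<otimes>\<^bsub>H\<^esub> y = y \<otimes>\<^bsub>H\<^esub> x"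
    using that by (rule H.group_comm_groupI)
  show False
  proof (cases "\<exists>g m. g \<in> carrier H \<and> g \<noteq> \<one>\<^bsub>H\<^esub> \<and> unimodular m \<and> \<phi> g = proj m \<and> P dvd mat_tr m ^ 2 - 4")
    case False
    have "x \<in> H.centralizer g"
      if gx: "g \<in> carrier H" "g \<noteq> \<one>\<^bsub>H\<^esub>" "x \<in> carrier H" "x \<otimes>\<^bsub>H\<^esub> g \<otimes>\<^bsub>H\<^esub> inv\<^bsub>H\<^esub> x \<in> H.centralizer g" for g x
    proof -
      obtain m where "unimodular m" "\<phi> g = proj m" using ex_lift[OF facts gx(1)] by blast
      with False gx show ?thesis using lift_self_normalizing[OF facts] by blast
    qed
    then have "comm_group H"
      by (intro abelian H.commutative_by_centralizer_count[OF fin lift_commutation_transitive[OF facts]])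
    with nc show False by blast
  next
    case True
    then obtain g m where g: "g \<in> carrier H" "g \<noteq> \<one>\<^bsub>H\<^esub>" and m: "unimodular m" "\<phi> g = proj m"
      and "P dvd mat_tr m ^ 2 - 4" by blast
    then have "P dvd (mat_tr m - 2) * (mat_tr m + 2)" by (simp add: algebra_simps power2_eq_square)
    then have "[mat_tr m = 2] (mod P) \<or> [mat_tr m = - 2] (mod P)"
      unfolding P_dvd_mult by (simp add: cong_iff_dvd_diff)
    then obtain n where n: "unimodular n" "\<phi> g = proj n" "[mat_tr n = 2] (mod P)"
    proof
      assume "[mat_tr m = - 2] (mod P)"
      then have "[mat_tr (mat_scale (-1) m) = 2] (mod P)"
        using cong_minus_minus_iff[of "mat_tr m" "-2"] by (simp only: mat_tr_scale) simp
      with m that show thesis using unimodular_minus proj_minus by metis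
    qed (use m that in blast)
    have ns: "\<not> scalar_mat n" using lift_scalar_iff[OF facts g(1) n(1,2)] g(2) by blast
    have "[mat_tr n = mat_tr (upper 1)] (mod P)" using n(3) by (simp add: upper_def)
    then obtain h h' where h: "inverse_pair h h'" "upper 1 \<cong>\<^sub>p h \<star> n \<star> h'"
      using companion_conj[OF n(1) ns unimodular_upper upper_not_scalar] by blast
    define \<psi> where "\<psi> = conj_map h h' \<circ> \<phi>"
    have \<psi>: "\<psi> \<in> hom H PSL" unfolding \<psi>_def by (rule hom_compose[OF hom conj_map_hom[OF h(1)]])
    have \<psi>g: "\<psi> g = proj (upper 1)"
      unfolding \<psi>_def comp_def n(2) conj_map_proj[OF n(1)] by (rule proj_cong[OF h(2), symmetric])
    have "\<psi> g \<noteq> \<one>\<^bsub>PSL\<^esub>"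
      unfolding \<psi>g PSL_one using scalar_iff_proj[OF unimodular_upper] upper_not_scalar by blast
    then have "comm_group H"
      using g \<psi>g by (intro abelian commutative_if_unipotent[OF S H(2) \<psi>, of g]) auto
    with nc show False by blast
  qed
qed

end

section \<open>Values of characteristic collections\<close>

lemma coll_at_subset:
  fixes G :: "('a, 'b) monoid_scheme"
  assumes S: "characteristic S" and fin: "finite (carrier G)"
  shows "coll_at S G \<subseteq> carrier G"
proof
  fix y assume "y \<in> coll_at S G"
  then obtain \<phi> x and N :: "nat monoid"
    where N: "group N" "\<phi> \<in> iso N G" "x \<in> S N" "y = \<phi> x"
    unfolding coll_at_def by blast
  have "finite (carrier N)" using N(2) fin bij_betw_finite by (auto simp: iso_def)
  then have "x \<in> carrier N" using S N unfolding characteristic_def by blast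
  with N show "y \<in> carrier G" by (auto simp: iso_def hom_def)
qed

text \<open>
  A characteristic collection is preserved by the trivial endomorphism.
\<close>

lemma one_in_coll_at:
  fixes G :: "('a, 'b) monoid_scheme"
  assumes S: "characteristic S" and G: "group G" "finite (carrier G)"
  shows "\<one>\<^bsub>G\<^esub> \<in> coll_at S G"
proof -
  obtain N :: "nat monoid" and \<phi> where N: "group N" "finite (carrier N)" "\<phi> \<in> iso N G"
    using ex_nat_copy[OF G] .
  obtain x where x: "x \<in> S N" using S N unfolding characteristic_def by blast
  have "(\<lambda>_. \<one>\<^bsub>N\<^esub>) \<in> hom N N"
    using N(1) by (auto simp: hom_def group.is_monoid monoid.one_closed)
  from characteristic_hom[OF S N(1,2) N(1,2) this x] have "\<one>\<^bsub>N\<^esub> \<in> S N" .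
  moreover have "\<phi> \<one>\<^bsub>N\<^esub> = \<one>\<^bsub>G\<^esub>" using N G by (intro hom_one) (auto simp: iso_def)
  ultimately show ?thesis unfolding coll_at_def using N by (auto intro!: exI[of _ \<phi>] exI[of _ "\<one>\<^bsub>N\<^esub>"] exI[of _ N])
qed

lemma ample_coll_at_nontrivial:
  fixes G :: "('a, 'b) monoid_scheme"
  assumes S: "characteristic S" "ample S" and G: "finite_simple_nonab_group G"
  shows "\<exists>x \<in> coll_at S G. x \<noteq> \<one>\<^bsub>G\<^esub>"
proof -
  have simple: "simple_group G" and fin: "finite (carrier G)" and nc: "\<not> comm_group G"
    using G by (auto simp: finite_simple_nonab_group_def)
  interpret simple_group G by (rule simple)
  obtain N :: "nat monoid" and \<phi> where N: "group N" "finite (carrier N)" "\<phi> \<in> iso N G"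
    using ex_nat_copy[OF group_axioms fin] .
  interpret N: group N by (rule N(1))
  have iso: "\<phi> \<in> hom N G" "bij_betw \<phi> (carrier N) (carrier G)" using N(3) by (auto simp: iso_def)
  have "simple_group N"
    using iso_simple[OF N(1)] N.iso_set_sym[OF N(3)] by blast
  moreover have "\<not> comm_group N"
  proof
    assume "comm_group N"
    then have "comm_group G"
      using comm_group.iso_imp_comm_group[of N G] N(3) is_monoid by (auto simp: is_iso_def)
    with nc show False ..
  qed
  ultimately have "2 \<le> card (S N)"
    using S(2) N(2) unfolding ample_def finite_simple_nonab_group_def by blast
  then have "\<not> S N \<subseteq> {\<one>\<^bsub>N\<^esub>}" using card_mono[of "{\<one>\<^bsub>N\<^esub>}" "S N"] by force
  then obtain x where x: "x \<in> S N" "x \<noteq> \<one>\<^bsub>N\<^esub>" by blast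
  have "x \<in> carrier N" using S(1) N x unfolding characteristic_def by blast
  then have "\<phi> x \<noteq> \<one>\<^bsub>G\<^esub>"
    using x(2) iso hom_one[OF iso(1) N(1) group_axioms]
    by (metis N.one_closed bij_betw_imp_inj_on inj_on_eq_iff)
  moreover have "\<phi> x \<in> coll_at S G" unfolding coll_at_def using N x by blast
  ultimately show ?thesis by blast
qed

lemma ccn_eqI:
  assumes "\<And>Ss. length Ss = k \<Longrightarrow> \<forall>S \<in> set Ss. characteristic S \<and> ample S \<Longrightarrow>
      set_prod G (map (\<lambda>S. coll_at S G) Ss) = carrier G"
    and "\<And>n. n < k \<Longrightarrow> \<exists>Ss. length Ss = n \<and> (\<forall>S \<in> set Ss. characteristic S \<and> ample S) \<and>
      set_prod G (map (\<lambda>S. coll_at S G) Ss) \<noteq> carrier G"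
  shows "ccn G = enat k"
  unfolding ccn_def
proof (rule antisym)
  show "Inf {enat n |n. \<forall>Ss. length Ss = n \<and> (\<forall>S\<in>set Ss. characteristic S \<and> ample S) \<longrightarrow>
      set_prod G (map (\<lambda>S. coll_at S G) Ss) = carrier G} \<le> enat k"
    by (rule Inf_lower) (use assms(1) in blast)
  show "enat k \<le> Inf {enat n |n. \<forall>Ss. length Ss = n \<and> (\<forall>S\<in>set Ss. characteristic S \<and> ample S) \<longrightarrow>
      set_prod G (map (\<lambda>S. coll_at S G) Ss) = carrier G}"
  proof (rule Inf_greatest, clarify)
    fix n
    assume "\<forall>Ss. length Ss = n \<and> (\<forall>S\<in>set Ss. characteristic S \<and> ample S) \<longrightarrow>
      set_prod G (map (\<lambda>S. coll_at S G) Ss) = carrier G"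
    then have "\<not> n < k" using assms(2) by blast
    then show "enat k \<le> enat n" by simp
  qed
qed

text \<open>
  The second set makes the collection ample on simple groups without involutions. It is closed under
  composition with homomorphisms, hence characteristic.
\<close>

definition involution_collection :: collection
  where "involution_collection G = {x \<in> carrier G. x \<otimes>\<^bsub>G\<^esub> x = \<one>\<^bsub>G\<^esub>} \<union>
    {\<phi> x | \<phi> x (H :: nat monoid). finite_simple_nonab_group H \<and> involution_free H \<and>
      \<phi> \<in> hom H G \<and> x \<in> carrier H}"

lemma characteristic_involution_collection: "characteristic involution_collection"
  unfolding characteristic_def
proof (intro conjI allI impI)
  fix G :: "nat monoid" assume G: "group G \<and> finite (carrier G)"
  then interpret group G by blast
  have "\<one>\<^bsub>G\<^esub> \<in> involution_collection G" by (simp add: involution_collection_def)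
  then show "involution_collection G \<noteq> {}" by blast
  show "involution_collection G \<subseteq> carrier G"
    by (auto simp: involution_collection_def hom_def)
next
  fix G K :: "nat monoid" and \<psi>
  assume a: "group G \<and> finite (carrier G) \<and> group K \<and> finite (carrier K) \<and> \<psi> \<in> hom G K"
  then have psi: "\<psi> \<in> hom G K" and one: "\<psi> \<one>\<^bsub>G\<^esub> = \<one>\<^bsub>K\<^esub>" using hom_one[of \<psi> G K] by auto
  show "\<psi> ` involution_collection G \<subseteq> involution_collection K"
  proof
    fix y assume "y \<in> \<psi> ` involution_collection G"
    then obtain x where y: "y = \<psi> x" and x: "x \<in> involution_collection G" by blast
    from x consider "x \<in> carrier G" "x \<otimes>\<^bsub>G\<^esub> x = \<one>\<^bsub>G\<^esub>"
      | \<phi> h and H :: "nat monoid" where "finite_simple_nonab_group H" "involution_free H"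
        "\<phi> \<in> hom H G" "h \<in> carrier H" "x = \<phi> h"
      unfolding involution_collection_def by blast
    then show "y \<in> involution_collection K"
    proof cases
      case 1
      then have "y \<in> carrier K" "y \<otimes>\<^bsub>K\<^esub> y = \<one>\<^bsub>K\<^esub>"
        using psi one hom_mult[OF psi, of x x] by (auto simp: y hom_def)
      then show ?thesis by (simp add: involution_collection_def)
    next
      case 2
      have "\<psi> \<circ> \<phi> \<in> hom H K" by (rule hom_compose[OF 2(3) psi])
      moreover have "y = (\<psi> \<circ> \<phi>) h" by (simp add: y 2)
      ultimately show ?thesis using 2(1,2,4) unfolding involution_collection_def by blast
    qed
  qed
qed

lemma ample_involution_collection: "ample involution_collection"
  unfolding ample_def
proof (intro allI impI)
  fix G :: "nat monoid" assume G: "finite_simple_nonab_group G"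
  then have fin: "finite (carrier G)" and simple: "simple_group G"
    by (auto simp: finite_simple_nonab_group_def)
  interpret simple_group G by (rule simple)
  have sub: "involution_collection G \<subseteq> carrier G"
    by (auto simp: involution_collection_def hom_def)
  then have finI: "finite (involution_collection G)" using fin finite_subset by blast
  show "2 \<le> card (involution_collection G)"
  proof (cases "involution_free G")
    case True
    have "x \<in> involution_collection G" if "x \<in> carrier G" for x
    proof -
      have "id \<in> hom G G" by (simp add: hom_def)
      with G True that have "\<exists>\<phi> h (H :: nat monoid). x = \<phi> h \<and> finite_simple_nonab_group H \<and>
          involution_free H \<and> \<phi> \<in> hom H G \<and> h \<in> carrier H"
        by (intro exI[of _ id] exI[of _ x] exI[of _ G]) simp
      then show ?thesis unfolding involution_collection_def by blast
    qed
    then have "involution_collection G = carrier G" using sub by blast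
    then show ?thesis using order_gt_one by (simp add: order_def)
  next
    case False
    then obtain x where "x \<in> carrier G" "x \<otimes>\<^bsub>G\<^esub> x = \<one>\<^bsub>G\<^esub>" "x \<noteq> \<one>\<^bsub>G\<^esub>" by (auto simp: involution_free_def)
    then have "{x, \<one>\<^bsub>G\<^esub>} \<subseteq> involution_collection G" "card {x, \<one>\<^bsub>G\<^esub>} = 2"
      by (auto simp: involution_collection_def)
    then show ?thesis using card_mono[OF finI] by metis
  qed
qed

section \<open>The characteristic covering number\<close>

lemma (in monoid) set_mult_one: "X \<subseteq> carrier G \<Longrightarrow> X <#> {\<one>} = X"
  by (force simp: set_mult_def)

context psl2_prime begin

interpretation G: group PSL by (rule group_PSL)

lemma coll_at_contains_trace:
  assumes S: "characteristic S" "ample S"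
  obtains t where "contains_trace (coll_at S PSL) t"
proof -
  let ?X = "coll_at S PSL"
  obtain x where x: "x \<in> ?X" "x \<noteq> \<one>\<^bsub>PSL\<^esub>"
    using ample_coll_at_nontrivial[OF S finite_simple_PSL] by blast
  have "x \<in> carrier PSL" using coll_at_subset[OF S(1) finite_PSL] x(1) by blast
  then obtain m where m: "unimodular m" "x = proj m" unfolding PSL_carrier by blast
  have ns: "\<not> scalar_mat m" using x(2) scalar_iff_proj[OF m(1)] unfolding m PSL_one by blast
  have one: "proj mat_id \<in> ?X" using one_in_coll_at[OF S(1) group_PSL finite_PSL] unfolding PSL_one .
  have "proj (h \<star> n \<star> h') \<in> ?X" if h: "inverse_pair h h'" and n: "unimodular n" "proj n \<in> ?X" for h h' n
  proof -
    have "conj_map h h' ` ?X \<subseteq> ?X"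
      by (rule coll_at_hom[OF S(1) group_PSL finite_PSL group_PSL finite_PSL conj_map_hom[OF h]])
    then have "conj_map h h' (proj n) \<in> ?X" using n(2) by blast
    then show ?thesis unfolding conj_map_proj[OF n(1)] .
  qed
  from contains_trace_if_invariant[OF one this _ m(1) ns] x(1) have "contains_trace ?X (mat_tr m)"
    unfolding m(2) by blast
  then show thesis by (rule that)
qed

lemma coll_at_involution_collection:
  "coll_at involution_collection PSL \<subseteq> {x \<in> carrier PSL. x \<otimes>\<^bsub>PSL\<^esub> x = \<one>\<^bsub>PSL\<^esub>}"
proof
  fix y assume y: "y \<in> coll_at involution_collection PSL"
  then obtain \<psi> x and N :: "nat monoid"
    where N: "group N" "\<psi> \<in> iso N PSL" "x \<in> involution_collection N" "y = \<psi> x"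
    unfolding coll_at_def by blast
  have psi: "\<psi> \<in> hom N PSL" using N(2) by (simp add: iso_def)
  have yG: "y \<in> carrier PSL"
    using coll_at_subset[OF characteristic_involution_collection finite_PSL] y by blast
  from N(3) consider "x \<in> carrier N" "x \<otimes>\<^bsub>N\<^esub> x = \<one>\<^bsub>N\<^esub>"
    | \<phi> h and H :: "nat monoid" where "finite_simple_nonab_group H" "involution_free H"
      "\<phi> \<in> hom H N" "h \<in> carrier H" "x = \<phi> h"
    unfolding involution_collection_def by blast
  then have "y \<otimes>\<^bsub>PSL\<^esub> y = \<one>\<^bsub>PSL\<^esub>"
  proof cases
    case 1
    then show ?thesis using hom_mult[OF psi, of x x] hom_one[OF psi N(1) group_PSL] by (simp add: N(4))
  next
    case 2
    have "(\<psi> \<circ> \<phi>) h = \<one>\<^bsub>PSL\<^esub>"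
      by (rule odd_simple_hom_trivial[OF 2(1,2) hom_compose[OF 2(3) psi] 2(4)])
    then show ?thesis by (simp add: N(4) 2)
  qed
  with yG show "y \<in> {x \<in> carrier PSL. x \<otimes>\<^bsub>PSL\<^esub> x = \<one>\<^bsub>PSL\<^esub>}" by blast
qed

lemma upper_not_involution:
  "proj (upper 1) \<notin> {x \<in> carrier PSL. x \<otimes>\<^bsub>PSL\<^esub> x = \<one>\<^bsub>PSL\<^esub>}"
proof -
  have "mat_tr (upper 1) = 2" by (simp add: upper_def)
  then show ?thesis
    using proj_square[OF unimodular_upper, of 1] upper_not_scalar not_dvd_2 by simp
qed

text \<open>
  If \<open>xy\<close> is the transvection \<open>upper 1\<close>, neither factor is trivial, so matrices of \<open>x\<close> and of
  \<open>y = x (xy)\<close> both have trace 0. For \<open>x = (a, b, c, -a)\<close> the second trace is \<open>c\<close>, so the determinant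
  of \<open>x\<close> is \<open>-a^2\<close> and \<open>-1\<close> is a square.
\<close>

lemma upper_not_product_of_involutions:
  assumes p: "[p = 3] (mod 4)"
    and x: "x \<in> carrier PSL" "x \<otimes>\<^bsub>PSL\<^esub> x = \<one>\<^bsub>PSL\<^esub>"
    and y: "y \<in> carrier PSL" "y \<otimes>\<^bsub>PSL\<^esub> y = \<one>\<^bsub>PSL\<^esub>"
  shows "x \<otimes>\<^bsub>PSL\<^esub> y \<noteq> proj (upper 1)"
proof
  assume eq: "x \<otimes>\<^bsub>PSL\<^esub> y = proj (upper 1)"
  then have x1: "x \<noteq> \<one>\<^bsub>PSL\<^esub>" and y1: "y \<noteq> \<one>\<^bsub>PSL\<^esub>"
    using upper_not_involution x y by auto
  obtain m where m: "unimodular m" "x = proj m" using x(1) unfolding PSL_carrier by blast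
  obtain a b c d where m_eq: "m = (a, b, c, d)" by (cases m)
  have um: "unimodular (m \<star> upper 1)" by (rule unimodular_mul[OF m(1) unimodular_upper])
  have "y = x \<otimes>\<^bsub>PSL\<^esub> (x \<otimes>\<^bsub>PSL\<^esub> y)" using x y by (simp flip: G.m_assoc)
  also have "\<dots> = proj (m \<star> upper 1)" unfolding eq unfolding m(2) by (rule PSL_mult[OF m(1) unimodular_upper])
  finally have y_eq: "y = proj (m \<star> upper 1)" .
  have "P dvd mat_tr m"
    using x(2) x1 proj_square[OF m(1)] scalar_unimodular[OF _ m(1)] unfolding m(2) PSL_one by blast
  moreover have "P dvd mat_tr (m \<star> upper 1)"
    using y(2) y1 proj_square[OF um] scalar_unimodular[OF _ um] unfolding y_eq PSL_one by blast
  ultimately have t: "P dvd a + d" and "P dvd a + d + c"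
    by (simp_all add: m_eq upper_def add_ac)
  from dvd_diff[OF this(2,1)] have c: "P dvd c" by simp
  have det: "P dvd a * d - b * c - 1" using m(1) by (simp add: m_eq cong_iff_dvd_diff)
  have "P dvd (a * d - b * c - 1) - a * (a + d) + b * c"
    by (intro dvd_diff dvd_add dvd_mult t c det)
  also have "(a * d - b * c - 1) - a * (a + d) + b * c = - 1 - a ^ 2"
    by (simp add: algebra_simps power2_eq_square)
  finally have "[- 1 = a ^ 2] (mod P)" unfolding cong_iff_dvd_diff .
  then have "[p = 1] (mod 4)" using neg_one_square_iff by blast
  with p show False by (simp add: cong_def)
qed

lemma carrier_involutions_product:
  assumes "n < 2 \<or> n < 3 \<and> [p = 3] (mod 4)"
  shows "set_prod PSL (map (\<lambda>S. coll_at S PSL) (replicate n involution_collection)) \<noteq> carrier PSL"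
proof -
  let ?B = "coll_at involution_collection PSL"
  have B: "?B \<subseteq> carrier PSL"
    by (rule coll_at_subset[OF characteristic_involution_collection finite_PSL])
  have "proj (upper 1) \<notin> set_prod PSL (map (\<lambda>S. coll_at S PSL) (replicate n involution_collection))"
  proof -
    consider "n = 0" | "n = 1" | "n = 2" "[p = 3] (mod 4)" using assms by linarith
    then show ?thesis
    proof cases
      case 1
      then show ?thesis
        using upper_not_scalar scalar_iff_proj[OF unimodular_upper] by (simp add: set_prod_def PSL_one)
    next
      case 2
      then have "set_prod PSL (map (\<lambda>S. coll_at S PSL) (replicate n involution_collection)) = ?B"
        using G.set_mult_one[OF B] by (simp add: set_prod_def)
      then show ?thesis using upper_not_involution coll_at_involution_collection by blast
    next
      case 3
      then have "set_prod PSL (map (\<lambda>S. coll_at S PSL) (replicate n involution_collection)) = ?B <#>\<^bsub>PSL\<^esub> ?B"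
        using G.set_mult_one[OF B] by (simp add: set_prod_def numeral_2_eq_2)
      moreover have "proj (upper 1) \<notin> ?B <#>\<^bsub>PSL\<^esub> ?B"
      proof
        assume "proj (upper 1) \<in> ?B <#>\<^bsub>PSL\<^esub> ?B"
        then obtain x y where xy: "x \<in> ?B" "y \<in> ?B" "x \<otimes>\<^bsub>PSL\<^esub> y = proj (upper 1)"
          unfolding set_mult_def by auto
        then show False
          using coll_at_involution_collection upper_not_product_of_involutions[OF 3(2), of x y] by blast
      qed
      ultimately show ?thesis by simp
    qed
  qed
  moreover have "proj (upper 1) \<in> carrier PSL" unfolding PSL_carrier using unimodular_upper by blast
  ultimately show ?thesis by blast
qed

lemma ccn_PSL_eqI:
  assumes "\<And>Ss. length Ss = k \<Longrightarrow> \<forall>S \<in> set Ss. characteristic S \<and> ample S \<Longrightarrow>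
      carrier PSL \<subseteq> set_prod PSL (map (\<lambda>S. coll_at S PSL) Ss)"
    and "k = 2 \<or> k = 3 \<and> [p = 3] (mod 4)"
  shows "ccn PSL = enat k"
proof (rule ccn_eqI)
  fix Ss :: "collection list"
  assume Ss: "length Ss = k" "\<forall>S \<in> set Ss. characteristic S \<and> ample S"
  have "set_prod PSL (map (\<lambda>S. coll_at S PSL) Ts) \<subseteq> carrier PSL" if "set Ts \<subseteq> set Ss" for Ts
    using that
  proof (induction Ts)
    case (Cons T Ts)
    then have "coll_at T PSL \<subseteq> carrier PSL"
      using Ss(2) by (intro coll_at_subset finite_PSL) auto
    with Cons G.set_mult_closed show ?case by (simp add: set_prod_def)
  qed (simp add: set_prod_def)
  with assms(1)[OF Ss] show "set_prod PSL (map (\<lambda>S. coll_at S PSL) Ss) = carrier PSL" by blast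
next
  fix n assume "n < k"
  with assms(2) have "n < 2 \<or> n < 3 \<and> [p = 3] (mod 4)" by auto
  from carrier_involutions_product[OF this]
  show "\<exists>Ss. length Ss = n \<and> (\<forall>S \<in> set Ss. characteristic S \<and> ample S) \<and>
      set_prod PSL (map (\<lambda>S. coll_at S PSL) Ss) \<noteq> carrier PSL"
    using characteristic_involution_collection ample_involution_collection
    by (intro exI[of _ "replicate n involution_collection"]) auto
qed

lemma ccn_PSL_1_mod_4:
  assumes "[p = 1] (mod 4)"
  shows "ccn PSL = enat 2"
proof (rule ccn_PSL_eqI)
  fix Ss :: "collection list"
  assume "length Ss = 2" and Ss: "\<forall>S \<in> set Ss. characteristic S \<and> ample S"
  then obtain S T where Ss_eq: "Ss = [S, T]" by (auto simp: numeral_2_eq_2 length_Suc_conv)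
  with Ss have S: "characteristic S" "ample S" and T: "characteristic T" "ample T" by auto
  obtain s where s: "contains_trace (coll_at S PSL) s" using coll_at_contains_trace[OF S] .
  obtain t where t: "contains_trace (coll_at T PSL) t" using coll_at_contains_trace[OF T] .
  show "carrier PSL \<subseteq> set_prod PSL (map (\<lambda>S. coll_at S PSL) Ss)"
    using product_covers[OF s t] assms G.set_mult_one[OF coll_at_subset[OF T(1) finite_PSL]]
    by (simp add: Ss_eq set_prod_def)
qed simp

lemma ccn_PSL_3_mod_4:
  assumes "[p = 3] (mod 4)"
  shows "ccn PSL = enat 3"
proof (rule ccn_PSL_eqI)
  fix Ss :: "collection list"
  assume "length Ss = 3" and Ss: "\<forall>S \<in> set Ss. characteristic S \<and> ample S"
  then obtain S T U where Ss_eq: "Ss = [S, T, U]" by (auto simp: numeral_3_eq_3 length_Suc_conv)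
  with Ss have S: "characteristic S" "ample S" and T: "characteristic T" "ample T"
    and U: "characteristic U" "ample U" by auto
  obtain s where s: "contains_trace (coll_at S PSL) s" using coll_at_contains_trace[OF S] .
  obtain t where t: "contains_trace (coll_at T PSL) t" using coll_at_contains_trace[OF T] .
  obtain u where u: "contains_trace (coll_at U PSL) u" using coll_at_contains_trace[OF U] .
  have "contains_trace (coll_at T PSL <#>\<^bsub>PSL\<^esub> coll_at U PSL) 1"
    by (rule contains_trace_set_mult[OF t u]) (use not_dvd_small[of 3] in simp)
  from product_covers[OF s this]
  have "carrier PSL \<subseteq> coll_at S PSL <#>\<^bsub>PSL\<^esub> (coll_at T PSL <#>\<^bsub>PSL\<^esub> coll_at U PSL)"
    using not_dvd_small[of 1] by simp
  then show "carrier PSL \<subseteq> set_prod PSL (map (\<lambda>S. coll_at S PSL) Ss)"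
    using G.set_mult_one[OF coll_at_subset[OF U(1) finite_PSL]] by (simp add: Ss_eq set_prod_def)
qed (use assms in simp)

end

theorem proposition1p4:
  fixes p :: nat
  assumes "Factorial_Ring.prime p" and "p \<ge> 5"
  shows "([p = 1] (mod 4) \<longrightarrow> ccn (PSL2 p) = 2) \<and>
         ([p = 3] (mod 4) \<longrightarrow> ccn (PSL2 p) = 3)"
proof -
  interpret psl2_prime p by unfold_locales (fact assms)+
  show ?thesis using ccn_PSL_1_mod_4 ccn_PSL_3_mod_4 by (simp add: numeral_eq_enat)
qed

end
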